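(* Let $(\Omega,\mathcal F,(\mathcal F_t)_{t\in\mathbb R_+})$ be a filtered space with right-continuous filtration and $\mathcal F=\bigvee_t\mathcal F_t$, let $\mu,P$ be probability measures on it with $\mu\ll P$, let $z$ be the density process of $\mu$ with respect to $P$, and let $T$ be a stopping time. If $0<T(\omega)<\infty$, then for every $n\in\mathbb N$ denote by $k_n=k_n(\omega)$ the unique natural number such that $T(\omega)\in\big(\frac{k_n-1}{2^n},\frac{k_n}{2^n}\big]$. Then, $P$-a.s., $$\mathbf E_P[z_T|\mathcal F_{T-}]=\begin{cases}z_T,&\omega\in\{T=0\}\cup\{T=\infty\},\\[4pt]\displaystyle\lim_{n\to\infty}\frac{\mathbf E_P\big[z_{\frac{k_n}{2^n}}1_{\{\frac{k_n-1}{2^n}<T\le\frac{k_n}{2^n}\}}\big|\mathcal F_{\frac{k_n-1}{2^n}}\big]}{\mathbf E_P\big[1_{\{\frac{k_n-1}{2^n}<T\le\frac{k_n}{2^n}\}}\big|\mathcal F_{\frac{k_n-1}{2^n}}\big]},&\omega\in\{0<T<\infty\}.\end{cases}$$ Denote by $K_T(\omega)$ the following $\mathcal F_{T-}$-measurable function: $$K_T(\omega)=\begin{cases}1,&\omega\in B:=\{T=0\}\cup\{T=\infty\}\cup\{z_{T-}=0\},\\[4pt]\displaystyle\lim_{n\to\infty}\frac{\mathbf E_P\big[z_{\frac{k_n}{2^n}}1_{\{\frac{k_n-1}{2^n}<T\le\frac{k_n}{2^n}\}}\big|\mathcal F_{\frac{k_n-1}{2^n}}\big]}{z_{\frac{k_n-1}{2^n}}\cdot\mathbf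 E_P\big[1_{\{\frac{k_n-1}{2^n}<T\le\frac{k_n}{2^n}\}}\big|\mathcal F_{\frac{k_n-1}{2^n}}\big]},&\omega\in\Omega\setminus B.\end{cases}$$ Then $$\mathbf E_P[z_T|\mathcal F_{T-}]=z_{T-}\cdot K_T(\omega),\quad P\text{-a.s.}$$
   Context: Stopping times take values in $[0,\infty]$. $\mathcal F_{T-}$ is the $\sigma$-algebra generated by $\mathcal F_0$ and the sets $A\cap\{t<T\}$, $A\in\mathcal F_t$, $t\ge0$. The density process is $z_t=d\mu_t/dP_t$ (restrictions to $\mathcal F_t$), right-continuous with left limits, $z_\infty=d\mu/dP$; $z_{0-}=z_0$, $z_{t-}=\lim_{s\uparrow t}z_s$ for $0<t\le\infty$. In the formulas, the conditional expectations are taken for each fixed integer $k$ and then evaluated at $\omega$ with $k=k_n(\omega)$. *)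

theory Defs
  imports "HOL-Probability.Probability"
begin

text \<open>
  Time runs through \<^typ>\<open>ennreal\<close>, that is, through the closed half-line from 0 to infinity. A
  filtration indexed by the finite times is extended to infinity by the \<open>\<sigma>\<close>-algebra it generates,
  so that a \<^const>\<open>stopping_time\<close> of the library may take the value \<open>\<infinity>\<close>. Of a measure \<open>F t\<close>,
  only the space and the measurable sets matter.
\<close>

definition right_continuous_filtration :: "(ennreal \<Rightarrow> 'a measure) \<Rightarrow> bool" where
  "right_continuous_filtration F \<longleftrightarrow>
     (\<forall>t<\<infinity>. sets (F t) = (\<Inter>s\<in>{t<..<\<infinity>}. sets (F s)))"

definition strict_past :: "(ennreal \<Rightarrow> 'a measure) \<Rightarrow> ('a \<Rightarrow> ennreal) \<Rightarrow> 'a measure" where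
  "strict_past F T = sigma (space (F 0))
     (sets (F 0) \<union> {A \<inter> {\<omega>. t < T \<omega>} | A t. t < \<infinity> \<and> A \<in> sets (F t)})"

definition left_limit :: "(ennreal \<Rightarrow> real) \<Rightarrow> ennreal \<Rightarrow> real" where
  "left_limit x t = (if t = 0 then x 0 else Lim (at_left t) x)"

text \<open>
  The value at \<open>\<infinity>\<close> is covered by the first two clauses. All paths are required to be
  right-continuous, but left limits are required only almost surely: the filtration is not
  assumed to be complete, and then a version with left limits on all paths need not exist.
\<close>

definition density_process ::
  "'a measure \<Rightarrow> 'a measure \<Rightarrow> (ennreal \<Rightarrow> 'a measure) \<Rightarrow> (ennreal \<Rightarrow> 'a \<Rightarrow> real) \<Rightarrow> bool" where
  "density_process P \<mu> F z \<longleftrightarrow>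
     (\<forall>t. z t \<in> borel_measurable (F t)) \<and>
     (\<forall>t. AE \<omega> in P. z t \<omega> =
        enn2real (RN_deriv (restr_to_subalg P (F t)) (restr_to_subalg \<mu> (F t)) \<omega>)) \<and>
     (\<forall>\<omega>\<in>space P. \<forall>t<\<infinity>. continuous (at_right t) (\<lambda>s. z s \<omega>)) \<and>
     (AE \<omega> in P. \<forall>t. 0 < t \<and> t < \<infinity> \<longrightarrow> (\<exists>l. ((\<lambda>s. z s \<omega>) \<longlongrightarrow> l) (at_left t)))"

definition dyadic_left :: "nat \<Rightarrow> nat \<Rightarrow> ennreal" where
  "dyadic_left n k = ennreal ((real k - 1) / 2 ^ n)"

definition dyadic_right :: "nat \<Rightarrow> nat \<Rightarrow> ennreal" where
  "dyadic_right n k = ennreal (real k / 2 ^ n)"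

definition dyadic_cell :: "('a \<Rightarrow> ennreal) \<Rightarrow> nat \<Rightarrow> nat \<Rightarrow> 'a set" where
  "dyadic_cell T n k = {\<omega>. dyadic_left n k < T \<omega> \<and> T \<omega> \<le> dyadic_right n k}"

definition dyadic_index :: "('a \<Rightarrow> ennreal) \<Rightarrow> nat \<Rightarrow> 'a \<Rightarrow> nat" where
  "dyadic_index T n \<omega> = (THE k. \<omega> \<in> dyadic_cell T n k)"

definition cell_density ::
  "'a measure \<Rightarrow> (ennreal \<Rightarrow> 'a measure) \<Rightarrow> (ennreal \<Rightarrow> 'a \<Rightarrow> real) \<Rightarrow> ('a \<Rightarrow> ennreal)
     \<Rightarrow> nat \<Rightarrow> nat \<Rightarrow> 'a \<Rightarrow> real" where
  "cell_density P F z T n k =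
     real_cond_exp P (F (dyadic_left n k))
       (\<lambda>\<omega>. z (dyadic_right n k) \<omega> * indicator (dyadic_cell T n k) \<omega>)"

definition cell_prob ::
  "'a measure \<Rightarrow> (ennreal \<Rightarrow> 'a measure) \<Rightarrow> ('a \<Rightarrow> ennreal) \<Rightarrow> nat \<Rightarrow> nat \<Rightarrow> 'a \<Rightarrow> real" where
  "cell_prob P F T n k =
     real_cond_exp P (F (dyadic_left n k)) (indicator (dyadic_cell T n k))"

definition approx_E ::
  "'a measure \<Rightarrow> (ennreal \<Rightarrow> 'a measure) \<Rightarrow> (ennreal \<Rightarrow> 'a \<Rightarrow> real) \<Rightarrow> ('a \<Rightarrow> ennreal)
     \<Rightarrow> nat \<Rightarrow> 'a \<Rightarrow> real" where
  "approx_E P F z T n \<omega> = (let k = dyadic_index T n \<omega> in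
     cell_density P F z T n k \<omega> / cell_prob P F T n k \<omega>)"

definition approx_K ::
  "'a measure \<Rightarrow> (ennreal \<Rightarrow> 'a measure) \<Rightarrow> (ennreal \<Rightarrow> 'a \<Rightarrow> real) \<Rightarrow> ('a \<Rightarrow> ennreal)
     \<Rightarrow> nat \<Rightarrow> 'a \<Rightarrow> real" where
  "approx_K P F z T n \<omega> = (let k = dyadic_index T n \<omega> in
     cell_density P F z T n k \<omega> / (z (dyadic_left n k) \<omega> * cell_prob P F T n k \<omega>))"

definition K_exceptional :: "(ennreal \<Rightarrow> 'a \<Rightarrow> real) \<Rightarrow> ('a \<Rightarrow> ennreal) \<Rightarrow> 'a set" where
  "K_exceptional z T =
     {\<omega>. T \<omega> = 0} \<union> {\<omega>. T \<omega> = \<infinity>} \<union> {\<omega>. left_limit (\<lambda>t. z t \<omega>) (T \<omega>) = 0}"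

definition K_T ::
  "'a measure \<Rightarrow> (ennreal \<Rightarrow> 'a measure) \<Rightarrow> (ennreal \<Rightarrow> 'a \<Rightarrow> real) \<Rightarrow> ('a \<Rightarrow> ennreal)
     \<Rightarrow> 'a \<Rightarrow> real" where
  "K_T P F z T \<omega> =
     (if \<omega> \<in> K_exceptional z T then 1 else lim (\<lambda>n. approx_K P F z T n \<omega>))"

end

theory Submission
  imports Defs
begin

text \<open>
  Optional stopping gives \<open>\<integral>\<^sub>C z\<^sub>T dP = \<mu> C\<close> for every event \<open>C\<close> of the past of \<open>T\<close>, so that \<open>z\<close> at the
  right end point of a dyadic cell may be replaced by \<open>z\<^sub>T\<close> in the numerators. The quotients are then,
  on the \<open>k\<close>-th cell, the conditional expectation of \<open>z\<^sub>T\<close> given a discretised strict past \<open>G\<^sub>n\<close>; the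
  \<open>G\<^sub>n\<close> increase and generate the strict past, and Levy's upward theorem gives the first formula.
  Dividing by \<open>z\<close> at the left end points gives the second one where \<open>z\<^sub>T\<^sub>- \<noteq> 0\<close>. On \<open>{T = \<infinity>}\<close> it says
  that \<open>z\<^sub>t\<close> converges to \<open>z\<^sub>\<infinity>\<close>, again by Levy's theorem. On \<open>{z\<^sub>T\<^sub>- = 0}\<close> both sides vanish, since
  \<open>\<mu> (inf z < \<epsilon>) \<le> \<epsilon>\<close> shows that this event is \<open>\<mu>\<close>-null.
\<close>

subsection \<open>Maximal inequality and upward convergence\<close>

text \<open>The filtration is not completed, so nothing may be altered on a null set:
  \<open>K_T\<close> has to be measurable for the strict past at every point, including those where
  a left limit does not exist or the quotients diverge. Hence the existence of left limits is
  expressed through rational times before \<open>T\<close>, and default values are followed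
  explicitly. The quotients are an instance of Bayes' formula: on a dyadic cell the discretised past
  and \<open>F\<close> at the left end have the same traces, so conditioning on the former is
  conditioning on the latter followed by division by the conditional probability of the cell.
  Optional stopping rests on right-continuity along discretised times; the passage to the limit
  needs a bound on large values that is uniform in the discretisation. Levy's theorem is needed
  along a sequence and along the rational times, and is therefore proved for a countable set in a
  linear order, from a maximal inequality and the L1 density of functions known at a single
  time.\<close>

text \<open>
  If \<open>D t\<close> is the event that something happens at time \<open>t\<close>, splitting according to the first time at
  which it happens compares two measures on the union although they are only compared on each \<open>F t\<close>.
  With suitable \<open>\<nu>\<close> and \<open>\<rho>\<close> this gives both Doob's maximal inequality and the fact that \<open>z\<close> is
  \<open>\<mu>\<close>-almost surely bounded away from zero.
\<close>

lemma emeasure_first_passage_finite: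
  fixes F :: "'i::linorder \<Rightarrow> 'a measure"
  assumes "finite I"
    and sets: "\<And>t. sets (F t) \<subseteq> sets \<nu>" "sets \<rho> = sets \<nu>"
    and mono: "\<And>s t. s \<le> t \<Longrightarrow> sets (F s) \<subseteq> sets (F t)"
    and D: "\<And>t. t \<in> I \<Longrightarrow> D t \<in> sets (F t)"
    and le: "\<And>t A. t \<in> I \<Longrightarrow> A \<in> sets (F t) \<Longrightarrow> A \<subseteq> D t \<Longrightarrow> emeasure \<nu> A \<le> emeasure \<rho> A"
  shows "emeasure \<nu> (\<Union>t\<in>I. D t) \<le> emeasure \<rho> (\<Union>t\<in>I. D t)"
  using assms(1) D le
proof (induction I rule: finite_linorder_max_induct)
  case empty
  then show ?case by simp
next
  case (insert b I)
  let ?U = "\<Union>t\<in>I. D t"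
  have U: "?U \<in> sets (F b)"
  proof (rule sets.finite_UN)
    show "D t \<in> sets (F b)" if "t \<in> I" for t
      using insert.prems(1)[of t] insert.hyps(2) mono[of t b] that by (auto dest: less_imp_le)
  qed (rule insert.hyps)
  \<comment> \<open>This is the event that \<open>b\<close> is the first time. It is known at
    \<open>b\<close> because the induction adds the largest time last, so that \<open>?U\<close>
    involves earlier times only.\<close>
  have Db: "D b - ?U \<in> sets (F b)"
    using insert.prems(1) U by auto
  have eq: "(\<Union>t\<in>insert b I. D t) = ?U \<union> (D b - ?U)"
    by auto
  have "emeasure \<nu> (?U \<union> (D b - ?U)) = emeasure \<nu> ?U + emeasure \<nu> (D b - ?U)"
    using U Db sets by (intro plus_emeasure[symmetric]) auto
  also have "\<dots> \<le> emeasure \<rho> ?U + emeasure \<rho> (D b - ?U)"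
  proof (rule add_mono)
    show "emeasure \<nu> ?U \<le> emeasure \<rho> ?U"
      using insert.prems by (intro insert.IH) auto
    show "emeasure \<nu> (D b - ?U) \<le> emeasure \<rho> (D b - ?U)"
      using Db by (intro insert.prems(2)[of b]) auto
  qed
  also have "\<dots> = emeasure \<rho> (?U \<union> (D b - ?U))"
    using U Db sets by (intro plus_emeasure) auto
  finally show ?case
    unfolding eq .
qed

text \<open>Among infinitely many times, such as the rationals, there need not be a first one at
  which an event happens. Among finitely many there is, and continuity from below removes the
  restriction.\<close>

lemma emeasure_first_passage:
  fixes F :: "'i::linorder \<Rightarrow> 'a measure"
  assumes "countable I"
    and sets: "\<And>t. sets (F t) \<subseteq> sets \<nu>" "sets \<rho> = sets \<nu>"
    and mono: "\<And>s t. s \<le> t \<Longrightarrow> sets (F s) \<subseteq> sets (F t)"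
    and D: "\<And>t. t \<in> I \<Longrightarrow> D t \<in> sets (F t)"
    and le: "\<And>t A. t \<in> I \<Longrightarrow> A \<in> sets (F t) \<Longrightarrow> A \<subseteq> D t \<Longrightarrow> emeasure \<nu> A \<le> emeasure \<rho> A"
  shows "emeasure \<nu> (\<Union>t\<in>I. D t) \<le> emeasure \<rho> (\<Union>t\<in>I. D t)"
proof (cases "I = {}")
  case False
  define J where "J n = from_nat_into I ` {..n}" for n :: nat
  have J: "J n \<subseteq> I" "finite (J n)" for n
    using from_nat_into[OF False] by (auto simp: J_def)
  have I: "(\<Union>n. J n) = I"
  proof -
    have "(\<Union>n. J n) = range (from_nat_into I)"
      by (auto simp: J_def)
    then show ?thesis
      using range_from_nat_into[OF False assms(1)] by simp
  qed
  have U: "(\<Union>t\<in>J n. D t) \<in> sets \<nu>" for n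
    using J[of n] D sets by (intro sets.finite_UN) auto
  have eq: "(\<Union>t\<in>I. D t) = (\<Union>n. \<Union>t\<in>J n. D t)"
    unfolding I[symmetric] by auto
  have inc: "incseq (\<lambda>n. \<Union>t\<in>J n. D t)"
    by (intro monoI UN_mono) (auto simp: J_def)
  have "emeasure \<nu> (\<Union>t\<in>I. D t) = (SUP n. emeasure \<nu> (\<Union>t\<in>J n. D t))"
    unfolding eq using U by (intro SUP_emeasure_incseq[symmetric] inc) auto
  also have "\<dots> \<le> (SUP n. emeasure \<rho> (\<Union>t\<in>J n. D t))"
  proof (rule SUP_mono)
    show "\<exists>m\<in>UNIV. emeasure \<nu> (\<Union>t\<in>J n. D t) \<le> emeasure \<rho> (\<Union>t\<in>J m. D t)" for n
      using J[of n] by (intro bexI[of _ n] emeasure_first_passage_finite[where F=F] sets mono D le) auto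
  qed
  also have "\<dots> = emeasure \<rho> (\<Union>t\<in>I. D t)"
    unfolding eq using U sets by (intro SUP_emeasure_incseq inc) auto
  finally show ?thesis .
qed simp

section \<open>Levy's upward theorem over a countable set of times\<close>

lemma (in finite_measure) sigma_finite_subalgebraI:
  assumes "subalgebra M G"
  shows "sigma_finite_subalgebra M G"
  by (intro finite_measure_subalgebra_is_sigma_finite finite_measure_subalgebra.intro
    finite_measure_subalgebra_axioms.intro assms finite_measure_axioms)

lemma emeasure_Markov_abs:
  fixes f :: "'a \<Rightarrow> real"
  assumes [measurable]: "integrable M f" and "A \<in> sets M" and "\<And>x. x \<in> A \<Longrightarrow> c \<le> \<bar>f x\<bar>" "0 \<le> c"
  shows "ennreal c * emeasure M A \<le> ennreal (\<integral>x. \<bar>f x\<bar> \<partial>M)"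
proof -
  have "ennreal c * emeasure M A = (\<integral>\<^sup>+x. ennreal c * indicator A x \<partial>M)"
    using assms(2) by (simp add: nn_integral_cmult_indicator)
  also have "\<dots> \<le> (\<integral>\<^sup>+x. ennreal \<bar>f x\<bar> \<partial>M)"
    using assms by (intro nn_integral_mono) (auto simp: indicator_def ennreal_leI)
  also have "\<dots> = ennreal (\<integral>x. \<bar>f x\<bar> \<partial>M)"
    using assms by (intro nn_integral_eq_integral) auto
  finally show ?thesis .
qed

text \<open>The index is a linear order with a countable set of times because two cases are needed:
  \<open>dyadic_past\<close> indexed by the naturals, and \<open>F\<close> at the rational
  times.\<close>

locale filtered_prob_space = prob_space M for M :: "'a measure" +
  fixes F :: "'i::linorder \<Rightarrow> 'a measure" and I :: "'i set"
  assumes subalgebra_F: "\<And>t. subalgebra M (F t)"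
    and sets_F_mono: "\<And>s t. s \<le> t \<Longrightarrow> sets (F s) \<subseteq> sets (F t)"
    and countable_I: "countable I"
    and I_nonempty: "I \<noteq> {}"
begin

text \<open>The L1 closure of the integrable functions known at a single time of \<open>I\<close>.
  For those the conditional expectations are eventually constant, and the maximal inequality carries
  convergence over to the closure.\<close>

definition L1_approx :: "('a \<Rightarrow> real) \<Rightarrow> bool" where
  "L1_approx f \<longleftrightarrow> (\<forall>e>0. \<exists>t\<in>I. \<exists>W. W \<in> borel_measurable (F t) \<and> integrable M W \<and> (\<integral>x. \<bar>f x - W x\<bar> \<partial>M) < e)"

lemma measurable_F_mono: "s \<le> t \<Longrightarrow> f \<in> borel_measurable (F s) \<Longrightarrow> f \<in> borel_measurable (F t)"
  using sets_F_mono subalgebra_F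
  by (auto simp: subalgebra_def intro: measurable_from_subalg[where F="F s" and M="F t"])

lemma L1_approx_add:
  assumes f: "L1_approx f" "integrable M f" and g: "L1_approx g" "integrable M g"
  shows "L1_approx (\<lambda>x. f x + g x)"
  unfolding L1_approx_def
proof (intro allI impI)
  fix e :: real assume "0 < e"
  then obtain s V t W where V: "s \<in> I" "V \<in> borel_measurable (F s)" "integrable M V" "(\<integral>x. \<bar>f x - V x\<bar> \<partial>M) < e/2"
    and W: "t \<in> I" "W \<in> borel_measurable (F t)" "integrable M W" "(\<integral>x. \<bar>g x - W x\<bar> \<partial>M) < e/2"
    using f(1) g(1) unfolding L1_approx_def by (meson half_gt_zero)
  have [measurable]: "V \<in> borel_measurable (F (max s t))" "W \<in> borel_measurable (F (max s t))"
    by (rule measurable_F_mono[OF max.cobounded1 V(2)], rule measurable_F_mono[OF max.cobounded2 W(2)])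
  have "(\<integral>x. \<bar>f x + g x - (V x + W x)\<bar> \<partial>M) \<le> (\<integral>x. \<bar>f x - V x\<bar> + \<bar>g x - W x\<bar> \<partial>M)"
    using f g V W by (intro integral_mono) auto
  also have "\<dots> = (\<integral>x. \<bar>f x - V x\<bar> \<partial>M) + (\<integral>x. \<bar>g x - W x\<bar> \<partial>M)"
    using f g V W by (intro Bochner_Integration.integral_add) auto
  also have "\<dots> < e"
    using V W by simp
  finally show "\<exists>t\<in>I. \<exists>W. W \<in> borel_measurable (F t) \<and> integrable M W \<and> (\<integral>x. \<bar>f x + g x - W x\<bar> \<partial>M) < e"
    using V(1,3) W(1,3)
    by (intro bexI[of _ "max s t"] exI[of _ "\<lambda>x. V x + W x"] conjI) (simp, simp, simp, simp add: max_def)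
qed

lemma L1_approx_cmult:
  assumes "L1_approx f"
  shows "L1_approx (\<lambda>x. f x * c)"
  unfolding L1_approx_def
proof (intro allI impI)
  fix e :: real assume "0 < e"
  \<comment> \<open>Adding 1 covers \<open>c = 0\<close>.\<close>
  then have "0 < e / (\<bar>c\<bar> + 1)" by simp
  then obtain t W where W: "t \<in> I" "W \<in> borel_measurable (F t)" "integrable M W" "(\<integral>x. \<bar>f x - W x\<bar> \<partial>M) < e / (\<bar>c\<bar> + 1)"
    using assms unfolding L1_approx_def by meson
  have "(\<integral>x. \<bar>f x * c - W x * c\<bar> \<partial>M) = (\<integral>x. \<bar>f x - W x\<bar> * \<bar>c\<bar> \<partial>M)"
    by (simp add: left_diff_distrib[symmetric] abs_mult)
  also have "\<dots> = (\<integral>x. \<bar>f x - W x\<bar> \<partial>M) * \<bar>c\<bar>"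
    by simp
  also have "\<dots> \<le> (\<integral>x. \<bar>f x - W x\<bar> \<partial>M) * (\<bar>c\<bar> + 1)"
    by (intro mult_left_mono) auto
  also have "\<dots> < e"
    using W(4) by (simp add: pos_less_divide_eq)
  finally show "\<exists>t\<in>I. \<exists>W. W \<in> borel_measurable (F t) \<and> integrable M W \<and> (\<integral>x. \<bar>f x * c - W x\<bar> \<partial>M) < e"
    using W by (intro bexI[of _ t] exI[of _ "\<lambda>x. W x * c"]) auto
qed

lemma L1_approx_measurable:
  assumes "t \<in> I" "f \<in> borel_measurable (F t)" "integrable M f"
  shows "L1_approx f"
  unfolding L1_approx_def using assms by (auto intro!: bexI[of _ t] exI[of _ f])

lemma L1_approx_limit:
  assumes f: "integrable M f" and s: "\<And>i::nat. integrable M (s i)" "\<And>i. L1_approx (s i)"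
    and lim: "(\<lambda>i. \<integral>x. \<bar>f x - s i x\<bar> \<partial>M) \<longlonglongrightarrow> 0"
  shows "L1_approx f"
  unfolding L1_approx_def
proof (intro allI impI)
  fix e :: real assume "0 < e"
  have "eventually (\<lambda>i. (\<integral>x. \<bar>f x - s i x\<bar> \<partial>M) < e/2) sequentially"
    using lim \<open>0 < e\<close> by (intro order_tendstoD) auto
  then obtain i where i: "(\<integral>x. \<bar>f x - s i x\<bar> \<partial>M) < e/2"
    by (auto simp: eventually_sequentially)
  obtain t W where W: "t \<in> I" "W \<in> borel_measurable (F t)" "integrable M W" "(\<integral>x. \<bar>s i x - W x\<bar> \<partial>M) < e/2"
    using s(2)[of i] \<open>0 < e\<close> unfolding L1_approx_def by (meson half_gt_zero)
  have "(\<integral>x. \<bar>f x - W x\<bar> \<partial>M) \<le> (\<integral>x. \<bar>f x - s i x\<bar> + \<bar>s i x - W x\<bar> \<partial>M)"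
    using f s(1)[of i] W by (intro integral_mono) auto
  also have "\<dots> = (\<integral>x. \<bar>f x - s i x\<bar> \<partial>M) + (\<integral>x. \<bar>s i x - W x\<bar> \<partial>M)"
    using f s(1)[of i] W by (intro Bochner_Integration.integral_add) auto
  also have "\<dots> < e"
    using W i by simp
  finally show "\<exists>t\<in>I. \<exists>W. W \<in> borel_measurable (F t) \<and> integrable M W \<and> (\<integral>x. \<bar>f x - W x\<bar> \<partial>M) < e"
    using W by blast
qed

definition F_limit :: "'a measure" where
  "F_limit = sigma (space M) (\<Union>t\<in>I. sets (F t))"

lemma generator_Pow: "(\<Union>t\<in>I. sets (F t)) \<subseteq> Pow (space M)"
  using subalgebra_F sets.space_closed by (fastforce simp: subalgebra_def)

lemma sets_F_limit: "sets F_limit = sigma_sets (space M) (\<Union>t\<in>I. sets (F t))"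
  unfolding F_limit_def using generator_Pow by (rule sets_measure_of)

lemma space_F_limit: "space F_limit = space M"
  unfolding F_limit_def using generator_Pow by (rule space_measure_of)

lemma subalgebra_F_limit: "subalgebra M F_limit"
  using subalgebra_F unfolding subalgebra_def space_F_limit sets_F_limit
  by (auto intro!: sets.sigma_sets_subset)

text \<open>The sets whose indicator can be approximated form a Dynkin system, and the generator is
  closed under intersections because two times have a maximum.\<close>

lemma L1_approx_indicator:
  assumes "A \<in> sets F_limit"
  shows "L1_approx (indicator A)"
proof -
  have stable: "Int_stable (\<Union>t\<in>I. sets (F t))"
  proof (rule Int_stableI)
    fix a b assume "a \<in> (\<Union>t\<in>I. sets (F t))" "b \<in> (\<Union>t\<in>I. sets (F t))"
    then obtain s t where "s \<in> I" "t \<in> I" "a \<in> sets (F s)" "b \<in> sets (F t)" by auto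
    then show "a \<inter> b \<in> (\<Union>t\<in>I. sets (F t))"
      using sets_F_mono[of s "max s t", OF max.cobounded1] sets_F_mono[of t "max s t", OF max.cobounded2]
      by (intro UN_I[of "max s t"] sets.Int) (auto simp: max_def)
  qed
  have meas: "A \<in> sets M" if "A \<in> sigma_sets (space M) (\<Union>t\<in>I. sets (F t))" for A
    using that subalgebra_F_limit unfolding subalgebra_def sets_F_limit by auto
  have "A \<in> sigma_sets (space M) (\<Union>t\<in>I. sets (F t))"
    using assms by (simp add: sets_F_limit)
  from stable generator_Pow this show ?thesis
  proof (induction rule: sigma_sets_induct_disjoint)
    case (basic A)
    then obtain t where t: "t \<in> I" "A \<in> sets (F t)" by auto
    then have "A \<in> sets M" using subalgebra_F[of t] by (auto simp: subalgebra_def)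
    with t show ?case
      by (intro L1_approx_measurable[of t]) (auto simp: emeasure_eq_measure)
  next
    case empty
    show ?case using I_nonempty by (auto intro!: L1_approx_measurable simp: indicator_def)
  next
    case (compl A)
    note [measurable] = meas[OF compl.hyps]
    obtain t0 where "t0 \<in> I" using I_nonempty by auto
    have 1: "L1_approx (\<lambda>x. 1 + indicator A x * (-1))"
      using \<open>t0 \<in> I\<close> by (intro L1_approx_add L1_approx_cmult compl L1_approx_measurable[of t0])
        (auto simp: emeasure_eq_measure)
    \<comment> \<open>The indicator of the complement is \<open>1 - indicator A\<close> only on
      \<open>space M\<close>, so the integrals are identified and not the functions.\<close>
    have eq: "(\<integral>x. \<bar>indicator (space M - A) x - W x\<bar> \<partial>M) = (\<integral>x. \<bar>1 + indicator A x * (-1) - W x\<bar> \<partial>M)" for W :: "'a \<Rightarrow> real"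
      by (intro Bochner_Integration.integral_cong) (auto simp: indicator_def)
    show ?case
      using 1 unfolding L1_approx_def eq .
  next
    case (union A)
    note A[measurable] = meas[OF subsetD[OF union.hyps(2) rangeI]]
    have [measurable]: "(\<Union>i. A i) \<in> sets M" by auto
    define s where "s n x = (\<Sum>i<n. indicator (A i) x :: real)" for n x
    have s_eq: "s n x = indicator (\<Union>i<n. A i) x" for n x
      unfolding s_def using union.hyps(1) by (intro indicator_UN_disjoint[symmetric]) (auto intro: disjoint_family_on_mono)
    have int: "integrable M (s n)" for n
      unfolding s_eq[abs_def] by (auto simp: emeasure_eq_measure)
    have "L1_approx (s n)" for n
    proof (induction n)
      case 0
      show ?case using I_nonempty by (auto intro!: L1_approx_measurable simp: s_def)
    next
      case (Suc n)
      have "L1_approx (\<lambda>x. s n x + indicator (A n) x)"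
        using Suc union.IH int by (intro L1_approx_add) (auto simp: emeasure_eq_measure)
      then show ?case by (simp add: s_def)
    qed
    moreover have "(\<lambda>n. \<integral>x. \<bar>indicator (\<Union>i. A i) x - s n x\<bar> \<partial>M) \<longlonglongrightarrow> (\<integral>x. 0 \<partial>M)"
    proof (rule integral_dominated_convergence[where w="\<lambda>_. 1"])
      show "AE x in M. (\<lambda>n. \<bar>indicator (\<Union>i. A i) x - s n x\<bar>) \<longlonglongrightarrow> 0"
        unfolding s_eq
      proof (intro AE_I2 tendsto_eventually)
        fix x
        show "\<forall>\<^sub>F n in sequentially. \<bar>indicator (\<Union>i. A i) x - indicator (\<Union>i<n. A i) x :: real\<bar> = 0"
        proof (cases "\<exists>i. x \<in> A i")
          case True
          then obtain i where "x \<in> A i" ..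
          then show ?thesis
            by (intro eventually_sequentiallyI[of "Suc i"]) (auto simp: indicator_def Suc_le_eq)
        qed (auto simp: indicator_def)
      qed
    qed (auto simp: s_eq indicator_def intro!: borel_measurable_abs borel_measurable_diff borel_measurable_indicator)
    moreover have "integrable M (indicator (\<Union>i. A i) :: 'a \<Rightarrow> real)"
      by (simp add: emeasure_eq_measure)
    ultimately show ?case
      using L1_approx_limit[of "indicator (\<Union>i. A i)" s, OF _ int] by simp
  qed
qed

lemma L1_approx_integrable:
  assumes "integrable M f" "f \<in> borel_measurable F_limit"
  shows "L1_approx f"
proof -
  \<comment> \<open>The induction runs on the restricted measure so that its sets and simple
    functions are measurable for \<open>F_limit\<close>, not merely for \<open>M\<close>.\<close>
  have "integrable (restr_to_subalg M F_limit) f"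
    by (intro integrable_in_subalg subalgebra_F_limit assms)
  then show ?thesis
  proof (induction f rule: integrable_induct)
    case (base A c)
    then show ?case
      using L1_approx_cmult[OF L1_approx_indicator, of A c] by (simp add: sets_restr_to_subalg[OF subalgebra_F_limit])
  next
    case (add f g)
    then show ?case
      by (intro L1_approx_add integrable_from_subalg[OF subalgebra_F_limit])
  next
    case (lim f s)
    note int = integrable_from_subalg[OF subalgebra_F_limit]
    \<comment> \<open>The induction rule provides
      \<open>\<bar>s i x\<bar> \<le> 2 * \<bar>f x\<bar>\<close>, hence the factor 3 in the
      dominating function.\<close>
    have "(\<lambda>i. \<integral>x. \<bar>f x - s i x\<bar> \<partial>M) \<longlonglongrightarrow> (\<integral>x. 0 \<partial>M)"
    proof (rule integral_dominated_convergence[where w="\<lambda>x. 3 * \<bar>f x\<bar>"])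
      show "AE x in M. (\<lambda>i. \<bar>f x - s i x\<bar>) \<longlonglongrightarrow> 0"
      proof (rule AE_I2)
        fix x assume "x \<in> space M"
        then have "(\<lambda>i. s i x) \<longlonglongrightarrow> f x" using lim by (simp add: space_restr_to_subalg)
        then have "(\<lambda>i. \<bar>f x - s i x\<bar>) \<longlonglongrightarrow> \<bar>f x - f x\<bar>"
          by (intro tendsto_intros)
        then show "(\<lambda>i. \<bar>f x - s i x\<bar>) \<longlonglongrightarrow> 0" by simp
      qed
      show "AE x in M. norm \<bar>f x - s i x\<bar> \<le> 3 * \<bar>f x\<bar>" for i
      proof (rule AE_I2)
        fix x assume "x \<in> space M"
        then have "\<bar>s i x\<bar> \<le> 2 * \<bar>f x\<bar>" using lim by (simp add: space_restr_to_subalg)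
        then show "norm \<bar>f x - s i x\<bar> \<le> 3 * \<bar>f x\<bar>" by simp
      qed
    qed (use int[OF \<open>integrable (restr_to_subalg M F_limit) f\<close>] int[OF \<open>integrable (restr_to_subalg M F_limit) (s _)\<close>] in auto)
    then have "(\<lambda>i. \<integral>x. \<bar>f x - s i x\<bar> \<partial>M) \<longlonglongrightarrow> 0"
      by simp
    with int[OF \<open>integrable (restr_to_subalg M F_limit) f\<close>]
      int[OF \<open>integrable (restr_to_subalg M F_limit) (s _)\<close>] \<open>L1_approx (s _)\<close>
    show ?case
      by (rule L1_approx_limit)
  qed
qed

lemma sigma_finite_subalgebra_F: "sigma_finite_subalgebra M (F t)"
  using subalgebra_F by (rule sigma_finite_subalgebraI)

text \<open>On an event of \<open>F t\<close> inside \<open>D t\<close>, \<open>c\<close> is at most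
  the conditional expectation of \<open>\<bar>f\<bar>\<close>, which integrates there to the same
  value as \<open>\<bar>f\<bar>\<close>. So \<open>c\<close> times \<open>M\<close> and the measure
  with density \<open>\<bar>f\<bar>\<close> can be compared by first passage. Working with events
  instead of a supremum leaves the versions of the conditional expectations free.\<close>

lemma Doob_maximal_inequality:
  assumes f: "integrable M f" and "0 \<le> c"
    and D: "\<And>t. t \<in> I \<Longrightarrow> D t \<in> sets (F t)"
    and X: "\<And>t. t \<in> I \<Longrightarrow> AE x in M. x \<in> D t \<longrightarrow> c \<le> \<bar>real_cond_exp M (F t) f x\<bar>"
  shows "ennreal c * emeasure M (\<Union>t\<in>I. D t) \<le> ennreal (\<integral>x. \<bar>f x\<bar> \<partial>M)"
proof -
  have [measurable]: "f \<in> borel_measurable M" using f by auto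
  have sets_F: "sets (F t) \<subseteq> sets M" for t
    using subalgebra_F by (auto simp: subalgebra_def)
  let ?\<nu> = "scale_measure (ennreal c) M" and ?\<rho> = "density M (\<lambda>x. ennreal \<bar>f x\<bar>)"
  have U: "(\<Union>t\<in>I. D t) \<in> sets M"
    using D sets_F countable_I by (intro sets.countable_UN') auto
  have "emeasure ?\<nu> (\<Union>t\<in>I. D t) \<le> emeasure ?\<rho> (\<Union>t\<in>I. D t)"
  proof (rule emeasure_first_passage[where F=F])
    fix t A assume t: "t \<in> I" and A[measurable]: "A \<in> sets (F t)" and AD: "A \<subseteq> D t"
    interpret sigma_finite_subalgebra M "F t" by (rule sigma_finite_subalgebra_F)
    have [measurable]: "A \<in> sets M" using A sets_F[of t] by blast
    have "emeasure ?\<nu> A = (\<integral>\<^sup>+x. ennreal c * indicator A x \<partial>M)"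
      by (simp add: nn_integral_cmult_indicator)
    also have "\<dots> \<le> (\<integral>\<^sup>+x. indicator A x * nn_cond_exp M (F t) (\<lambda>x. ennreal \<bar>f x\<bar>) x \<partial>M)"
    proof (rule nn_integral_mono_AE)
      have "AE x in M. \<bar>real_cond_exp M (F t) f x\<bar> \<le> nn_cond_exp M (F t) (\<lambda>x. ennreal \<bar>f x\<bar>) x"
        by (rule real_cond_exp_abs) simp
      then show "AE x in M. ennreal c * indicator A x \<le> indicator A x * nn_cond_exp M (F t) (\<lambda>x. ennreal \<bar>f x\<bar>) x"
        using X[OF t]
      proof eventually_elim
        case (elim x)
        then show ?case
          using AD by (auto simp: indicator_def intro: order_trans[OF ennreal_leI])
      qed
    qed
    also have "\<dots> = (\<integral>\<^sup>+x. indicator A x * ennreal \<bar>f x\<bar> \<partial>M)"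
      by (intro nn_cond_exp_intg) auto
    also have "\<dots> = emeasure ?\<rho> A"
      by (simp add: emeasure_density mult.commute)
    finally show "emeasure ?\<nu> A \<le> emeasure ?\<rho> A" .
  qed (use countable_I sets_F sets_F_mono D in auto)
  also have "\<dots> \<le> emeasure ?\<rho> (space ?\<rho>)"
    by (rule emeasure_space)
  also have "\<dots> = (\<integral>\<^sup>+x. ennreal \<bar>f x\<bar> \<partial>M)"
    by (simp add: emeasure_density cong: nn_integral_cong)
  also have "\<dots> = ennreal (\<integral>x. \<bar>f x\<bar> \<partial>M)"
    using f by (intro nn_integral_eq_integral) auto
  finally show ?thesis
    using U by simp
qed

text \<open>If \<open>W\<close> is known at time \<open>s\<close> and close to \<open>Y\<close> in
  L1, then for \<open>t\<close> after \<open>s\<close> the difference \<open>V t - W\<close> is a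
  conditional expectation of \<open>Y - W\<close>, and the maximal inequality controls all these
  \<open>t\<close> at once. Convergence is phrased by a threshold in \<open>I\<close> since the
  times need not form a sequence. The versions \<open>V t\<close> are prescribed so that the values
  of \<open>z\<close> itself can be inserted.\<close>

lemma Levy_upward:
  assumes Y: "integrable M Y" "Y \<in> borel_measurable F_limit"
    and V: "\<And>t. t \<in> I \<Longrightarrow> V t \<in> borel_measurable (F t)"
      "\<And>t. t \<in> I \<Longrightarrow> AE x in M. V t x = real_cond_exp M (F t) Y x"
  shows "AE x in M. \<forall>e>0. \<exists>s\<in>I. \<forall>t\<in>I. s \<le> t \<longrightarrow> \<bar>V t x - Y x\<bar> \<le> e"
proof -
  have VM[measurable]: "t \<in> I \<Longrightarrow> V t \<in> borel_measurable M" for t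
    using V(1) subalgebra_F measurable_from_subalg by blast
  have [measurable]: "Y \<in> borel_measurable M" using Y by auto
  have spF: "space (F t) = space M" for t
    using subalgebra_F by (auto simp: subalgebra_def)
  have *: "AE x in M. \<exists>s\<in>I. \<forall>t\<in>I. s \<le> t \<longrightarrow> \<bar>V t x - Y x\<bar> \<le> \<delta>" if \<delta>: "0 < \<delta>" for \<delta>
  proof -
    define B where "B = {x\<in>space M. \<not> (\<exists>s\<in>I. \<forall>t\<in>I. s \<le> t \<longrightarrow> \<bar>V t x - Y x\<bar> \<le> \<delta>)}"
    have B: "B = space M - (\<Union>s\<in>I. \<Inter>t\<in>{t\<in>I. s \<le> t}. {x\<in>space M. \<bar>V t x - Y x\<bar> \<le> \<delta>})"
      unfolding B_def by auto
    have [measurable]: "B \<in> sets M"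
      unfolding B
    proof (intro sets.Diff sets.top sets.countable_UN'' sets.countable_INT' countable_I countable_Collect)
      show "{t \<in> I. s \<le> t} \<noteq> {}" if "s \<in> I" for s using that by auto
    qed auto
    have bound: "prob B \<le> \<eta>" if "0 < \<eta>" for \<eta>
    proof -
      \<comment> \<open>A distance above \<open>\<delta>\<close> between \<open>V t\<close> and
        \<open>Y\<close> forces \<open>V t - W\<close> or \<open>Y - W\<close> to reach
        \<open>\<delta>/2\<close>; an L1 distance below \<open>\<eta> * \<delta> / 4\<close> leaves
        each of the two events a probability of at most \<open>\<eta>/2\<close>.\<close>
      have "0 < \<eta> * \<delta> / 4" using \<delta> that by simp
      then obtain s W where W: "s \<in> I" "W \<in> borel_measurable (F s)" "integrable M W"
          "(\<integral>x. \<bar>Y x - W x\<bar> \<partial>M) < \<eta> * \<delta> / 4"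
        using L1_approx_integrable[OF Y] unfolding L1_approx_def by meson
      \<comment> \<open>Before \<open>s\<close> the function \<open>W\<close> need not be known, so
        these times are discarded by an empty event.\<close>
      define D where "D t = (if s \<le> t then {x\<in>space M. \<delta>/2 \<le> \<bar>V t x - W x\<bar>} else {})" for t
      have D: "D t \<in> sets (F t)" if "t \<in> I" for t
      proof (cases "s \<le> t")
        case True
        then have [measurable]: "W \<in> borel_measurable (F t)" "V t \<in> borel_measurable (F t)"
          using measurable_F_mono W V that by auto
        have "{x\<in>space (F t). \<delta>/2 \<le> \<bar>V t x - W x\<bar>} \<in> sets (F t)"
          by measurable
        then show ?thesis using True by (simp add: D_def spF)
      qed (simp add: D_def)
      have DM: "D t \<in> sets M" if "t \<in> I" for t
        using D[OF that] subalgebra_F by (auto simp: subalgebra_def)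
      have 1: "ennreal (\<delta>/2) * emeasure M (\<Union>t\<in>I. D t) \<le> ennreal (\<integral>x. \<bar>Y x - W x\<bar> \<partial>M)"
      proof (rule Doob_maximal_inequality)
        fix t assume t: "t \<in> I"
        interpret sigma_finite_subalgebra M "F t" by (rule sigma_finite_subalgebra_F)
        show "AE x in M. x \<in> D t \<longrightarrow> \<delta>/2 \<le> \<bar>real_cond_exp M (F t) (\<lambda>x. Y x - W x) x\<bar>"
        proof (cases "s \<le> t")
          case True
          then have Wt: "W \<in> borel_measurable (F t)"
            using measurable_F_mono W by auto
          show ?thesis
            using real_cond_exp_diff[OF Y(1) W(3)] real_cond_exp_F_meas[OF W(3) Wt] V(2)[OF t]
            by eventually_elim (auto simp: D_def)
        qed (simp add: D_def)
      qed (use Y W D \<delta> in auto)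
      define D' where "D' = {x\<in>space M. \<delta>/2 \<le> \<bar>Y x - W x\<bar>}"
      have [measurable]: "W \<in> borel_measurable M" using W by auto
      have D'[measurable]: "D' \<in> sets M" unfolding D'_def by measurable
      have U[measurable]: "(\<Union>t\<in>I. D t) \<in> sets M"
        using DM countable_I by (intro sets.countable_UN') auto
      have 2: "ennreal (\<delta>/2) * emeasure M D' \<le> ennreal (\<integral>x. \<bar>Y x - W x\<bar> \<partial>M)"
        using Y W \<delta> by (intro emeasure_Markov_abs D') (auto simp: D'_def)
      have sub: "B \<subseteq> (\<Union>t\<in>I. D t) \<union> D'"
      proof
        fix x assume x: "x \<in> B"
        then obtain t where t: "t \<in> I" "s \<le> t" "\<delta> < \<bar>V t x - Y x\<bar>" "x \<in> space M"
          using W(1) unfolding B_def by (auto simp: not_le)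
        then have "\<delta>/2 \<le> \<bar>V t x - W x\<bar> \<or> \<delta>/2 \<le> \<bar>Y x - W x\<bar>"
          by linarith
        then show "x \<in> (\<Union>t\<in>I. D t) \<union> D'"
          using t by (auto simp: D_def D'_def)
      qed
      have 3: "\<delta>/2 * prob (\<Union>t\<in>I. D t) \<le> \<eta> * \<delta> / 4" "\<delta>/2 * prob D' \<le> \<eta> * \<delta> / 4"
        using 1 2 \<delta> less_imp_le[OF W(4)]
        by (auto simp del: times_divide_eq_left simp: emeasure_eq_measure ennreal_mult'[symmetric] intro: order_trans)
      have 4: "p \<le> \<eta>/2" if "\<delta>/2 * p \<le> \<eta> * \<delta> / 4" for p
        using mult_le_cancel_left_pos[of \<delta> "2 * p" \<eta>] that \<delta> by (simp add: mult.commute mult.left_commute)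
      have "prob B \<le> prob ((\<Union>t\<in>I. D t) \<union> D')"
        using sub by (intro finite_measure_mono) auto
      also have "\<dots> \<le> prob (\<Union>t\<in>I. D t) + prob D'"
        by (intro measure_Un_le) auto
      also have "\<dots> \<le> \<eta>/2 + \<eta>/2"
        using 4[OF 3(1)] 4[OF 3(2)] by (rule add_mono)
      finally show ?thesis by simp
    qed
    have "prob B \<le> 0"
    proof (rule field_le_epsilon)
      show "prob B \<le> 0 + e" if "0 < e" for e
        using bound[OF that] by simp
    qed
    then have "B \<in> null_sets M"
      by (auto simp: null_sets_def emeasure_eq_measure measure_le_0_iff)
    then show ?thesis
      by (rule AE_I') (auto simp: B_def)
  qed
  have "AE x in M. \<forall>n. \<exists>s\<in>I. \<forall>t\<in>I. s \<le> t \<longrightarrow> \<bar>V t x - Y x\<bar> \<le> 1 / real (Suc n)"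
    unfolding AE_all_countable by (intro allI *) simp
  then show ?thesis
  proof eventually_elim
    case (elim x)
    show ?case
    proof (intro allI impI)
      fix e :: real assume "0 < e"
      then obtain n where "1 / real (Suc n) < e"
        using nat_approx_posE by blast
      then show "\<exists>s\<in>I. \<forall>t\<in>I. s \<le> t \<longrightarrow> \<bar>V t x - Y x\<bar> \<le> e"
        using elim by (meson less_imp_le order_trans)
    qed
  qed
qed

end

subsection \<open>Right-continuous paths and dyadic times\<close>

definition rational_times :: "ennreal set" where
  "rational_times = range (\<lambda>r. ennreal (real_of_rat r))"

lemma countable_rational_times: "countable rational_times"
  by (simp add: rational_times_def)

lemma rational_times_finite: "q \<in> rational_times \<Longrightarrow> q < \<infinity>"
  by (auto simp: rational_times_def)

lemma rational_times_dense: "s < t \<Longrightarrow> \<exists>q\<in>rational_times. s < q \<and> q < t"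
  unfolding rational_times_def by (blast dest: ennreal_rat_dense)

text \<open>Otherwise right-continuity would keep \<open>x\<close> in the open complement of
  \<open>C\<close> just after \<open>u\<close>, where there is a rational time. This carries bounds
  from rational times to all times.\<close>

lemma right_continuous_closed_set:
  fixes x :: "ennreal \<Rightarrow> real"
  assumes rc: "continuous (at_right u) x" and u: "s \<le> u" "u < t"
    and C: "closed C" "\<And>q. q \<in> rational_times \<Longrightarrow> s < q \<Longrightarrow> q < t \<Longrightarrow> x q \<in> C"
  shows "x u \<in> C"
proof (rule ccontr)
  assume "x u \<notin> C"
  moreover have "(x \<longlongrightarrow> x u) (at_right u)"
    using rc by (simp add: continuous_within)
  ultimately have "eventually (\<lambda>v. x v \<in> - C) (at_right u)"
    using C(1) by (intro topological_tendstoD) auto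
  then obtain b where b: "b > u" "\<And>v. u < v \<Longrightarrow> v < b \<Longrightarrow> x v \<notin> C"
    unfolding eventually_at_right[OF u(2)] by auto
  obtain q where "q \<in> rational_times" "u < q" "q < min b t"
    using rational_times_dense[of u "min b t"] b u by auto
  then show False
    using b(2)[of q] C(2)[of q] le_less_trans[OF u(1), of q] by auto
qed

text \<open>Cauchy's criterion, tested at rational times only. It turns the existence of a left
  limit into countably many conditions, which is what makes it a measurable event.\<close>

lemma left_limit_exists_iff:
  fixes x :: "ennreal \<Rightarrow> real"
  assumes rc: "\<And>u. u < t \<Longrightarrow> continuous (at_right u) x" and t: "0 < t"
  shows "(\<exists>l. (x \<longlongrightarrow> l) (at_left t)) \<longleftrightarrow>
    (\<forall>n::nat. \<exists>q\<in>rational_times. q < t \<and> (\<forall>r\<in>rational_times. \<forall>r'\<in>rational_times.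
       q < r \<longrightarrow> r < t \<longrightarrow> q < r' \<longrightarrow> r' < t \<longrightarrow> \<bar>x r - x r'\<bar> \<le> 1 / real (Suc n)))"
    (is "_ \<longleftrightarrow> (\<forall>n. \<exists>q\<in>rational_times. q < t \<and> ?C q n)")
proof
  assume "\<exists>l. (x \<longlongrightarrow> l) (at_left t)"
  then obtain l where l: "(x \<longlongrightarrow> l) (at_left t)" ..
  show "\<forall>n. \<exists>q\<in>rational_times. q < t \<and> ?C q n"
  proof
    fix n
    have "eventually (\<lambda>s. dist (x s) l < 1 / real (Suc n) / 2) (at_left t)"
      using l by (rule tendstoD) simp
    then obtain b where b: "b < t" "\<And>s. b < s \<Longrightarrow> s < t \<Longrightarrow> dist (x s) l < 1 / real (Suc n) / 2"
      unfolding eventually_at_left[OF t] by blast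
    obtain q where q: "q \<in> rational_times" "b < q" "q < t"
      using rational_times_dense[OF b(1)] by auto
    have "\<bar>x r - x r'\<bar> \<le> 1 / real (Suc n)" if "q < r" "r < t" "q < r'" "r' < t" for r r'
    proof -
      have "dist (x r) l < 1 / real (Suc n) / 2" "dist (x r') l < 1 / real (Suc n) / 2"
        using b(2)[of r] b(2)[of r'] q that by auto
      then show ?thesis
        using dist_triangle_half_l[of "x r" l "1 / real (Suc n)" "x r'"] by (simp add: dist_real_def)
    qed
    with q show "\<exists>q\<in>rational_times. q < t \<and> ?C q n" by blast
  qed
next
  assume C: "\<forall>n. \<exists>q\<in>rational_times. q < t \<and> ?C q n"
  have all: "\<exists>q<t. \<forall>u v. q < u \<longrightarrow> u < t \<longrightarrow> q < v \<longrightarrow> v < t \<longrightarrow> \<bar>x u - x v\<bar> \<le> 1 / real (Suc n)" for n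
  proof -
    obtain q where q: "q < t" "?C q n" using C by blast
    have 1: "x u \<in> cball (x r) (1 / real (Suc n))" if "q < u" "u < t" "r \<in> rational_times" "q < r" "r < t" for u r
      using q that by (intro right_continuous_closed_set[OF rc, of u q t]) (auto simp: dist_real_def)
    \<comment> \<open>The two arguments are freed from rationality one after the other: now the ball
      is centred at the arbitrary \<open>x u\<close>, and the previous bound supplies the rational
      points in it.\<close>
    have 2: "x v \<in> cball (x u) (1 / real (Suc n))" if "q < u" "u < t" "q < v" "v < t" for u v
      using q that 1[of u] by (intro right_continuous_closed_set[OF rc, of v q t]) (auto simp: dist_commute[of "x u"])
    show ?thesis
      using q(1) 2 by (intro exI[of _ q]) (auto simp: dist_real_def)
  qed
  obtain u where u: "\<And>n. u n < t" "u \<longlonglongrightarrow> t"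
    using approx_from_below_dense_linorder[OF t] by blast
  have ev: "eventually (\<lambda>n. q < u n) sequentially" if "q < t" for q
    using order_tendstoD(1)[OF u(2) that] .
  have "Cauchy (\<lambda>n. x (u n))"
  proof (rule metric_CauchyI)
    fix e :: real assume "0 < e"
    then obtain n where n: "1 / real (Suc n) < e" using nat_approx_posE by blast
    obtain q where q: "q < t" "\<And>u v. q < u \<Longrightarrow> u < t \<Longrightarrow> q < v \<Longrightarrow> v < t \<Longrightarrow> \<bar>x u - x v\<bar> \<le> 1 / real (Suc n)"
      using all[of n] by blast
    obtain N where N: "\<And>k. N \<le> k \<Longrightarrow> q < u k"
      using ev[OF q(1)] unfolding eventually_sequentially by blast
    have "dist (x (u k)) (x (u m)) < e" if "N \<le> k" "N \<le> m" for k m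
      using q(2)[OF N[OF that(1)] u(1) N[OF that(2)] u(1)] n by (simp add: dist_real_def)
    then show "\<exists>N. \<forall>k\<ge>N. \<forall>m\<ge>N. dist (x (u k)) (x (u m)) < e"
      by blast
  qed
  then obtain l where l: "(\<lambda>n. x (u n)) \<longlonglongrightarrow> l"
    using Cauchy_convergent convergent_def by blast
  have "(x \<longlongrightarrow> l) (at_left t)"
  proof (rule tendstoI)
    fix e :: real assume "0 < e"
    then obtain n where n: "1 / real (Suc n) < e" using nat_approx_posE by blast
    obtain q where q: "q < t" "\<And>u v. q < u \<Longrightarrow> u < t \<Longrightarrow> q < v \<Longrightarrow> v < t \<Longrightarrow> \<bar>x u - x v\<bar> \<le> 1 / real (Suc n)"
      using all[of n] by blast
    have "dist (x v) l < e" if "q < v" "v < t" for v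
    proof -
      have "(\<lambda>k. dist (x v) (x (u k))) \<longlonglongrightarrow> dist (x v) l"
        by (intro tendsto_intros l)
      moreover have "eventually (\<lambda>k. dist (x v) (x (u k)) \<le> 1 / real (Suc n)) sequentially"
        using ev[OF q(1)] by eventually_elim (use q(2) that u(1) in \<open>simp add: dist_real_def\<close>)
      ultimately have "dist (x v) l \<le> 1 / real (Suc n)"
        by (intro tendsto_upperbound) auto
      with n show ?thesis by simp
    qed
    with q(1) show "eventually (\<lambda>s. dist (x s) l < e) (at_left t)"
      unfolding eventually_at_left[OF t] by blast
  qed
  then show "\<exists>l. (x \<longlongrightarrow> l) (at_left t)" ..
qed

lemma at_left_tendsto_rational:
  fixes x :: "ennreal \<Rightarrow> real"
  assumes rc: "\<And>u. u < t \<Longrightarrow> continuous (at_right u) x" and t: "0 < t"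
    and l: "\<And>e. 0 < e \<Longrightarrow> \<exists>s<t. \<forall>q\<in>rational_times. s \<le> q \<longrightarrow> q < t \<longrightarrow> \<bar>x q - l\<bar> \<le> e"
  shows "(x \<longlongrightarrow> l) (at_left t)"
proof (rule tendstoI)
  fix e :: real assume "0 < e"
  then have "0 < e / 2" by simp
  then obtain s where s: "s < t" "\<And>q. q \<in> rational_times \<Longrightarrow> s \<le> q \<Longrightarrow> q < t \<Longrightarrow> \<bar>x q - l\<bar> \<le> e / 2"
    using l by blast
  \<comment> \<open>The bound extends to all times on a closed ball; halving \<open>e\<close> makes
    it strict.\<close>
  have "x u \<in> cball l (e / 2)" if "s < u" "u < t" for u
    using s that by (intro right_continuous_closed_set[OF rc, of u s t]) (auto simp: dist_real_def abs_minus_commute)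
  then have "\<And>u. s < u \<Longrightarrow> u < t \<Longrightarrow> dist (x u) l < e"
    using \<open>0 < e\<close> by (force simp: dist_commute)
  with s(1) show "eventually (\<lambda>s. dist (x s) l < e) (at_left t)"
    unfolding eventually_at_left[OF t] by blast
qed

text \<open>
  The approximation from above is strict at finite times, so that it converges through
  \<open>at_right t\<close> and right-continuity applies.
\<close>

definition upper_dyadic :: "nat \<Rightarrow> ennreal \<Rightarrow> ennreal" where
  "upper_dyadic m t = (if t = \<infinity> then \<infinity> else dyadic_right m (Suc (nat \<lfloor>enn2real t * 2 ^ m\<rfloor>)))"

lemma upper_dyadic_range: "upper_dyadic m t \<in> insert \<infinity> (range (\<lambda>j. dyadic_right m (Suc j)))"
  by (auto simp: upper_dyadic_def)

lemma upper_dyadic_top [simp]: "upper_dyadic m top = top"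
  by (simp add: upper_dyadic_def)

lemma dyadic_right_finite [simp]: "dyadic_right m k < top" "dyadic_right m k \<noteq> top" "top \<noteq> dyadic_right m k"
  by (auto simp: dyadic_right_def)

lemma upper_dyadic_eq_infinity: "upper_dyadic m t = \<infinity> \<longleftrightarrow> t = \<infinity>"
  by (simp add: upper_dyadic_def)

lemma dyadic_right_eq_iff: "dyadic_right m j = dyadic_right m k \<longleftrightarrow> j = k"
  by (simp add: dyadic_right_def)

text \<open>These cells are closed on the left, unlike \<open>dyadic_cell\<close>. At a stopping
  time the value of \<open>upper_dyadic\<close> is therefore decided by strict inequalities
  \<open>T < s\<close> with \<open>s\<close> at most that value, and these are known by
  then.\<close>

lemma upper_dyadic_eq_iff:
  "upper_dyadic m t = dyadic_right m (Suc j) \<longleftrightarrow> dyadic_right m j \<le> t \<and> t < dyadic_right m (Suc j)"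
proof (cases t rule: ennreal_cases)
  case (real r)
  have "upper_dyadic m t = dyadic_right m (Suc j) \<longleftrightarrow> \<lfloor>r * 2 ^ m\<rfloor> = int j"
  proof -
    have "0 \<le> \<lfloor>r * 2 ^ m\<rfloor>"
      using real by simp
    then show ?thesis
      using real by (auto simp: upper_dyadic_def dyadic_right_eq_iff)
  qed
  also have "\<dots> \<longleftrightarrow> real j \<le> r * 2 ^ m \<and> r * 2 ^ m < real j + 1"
    by (simp add: floor_eq_iff)
  also have "\<dots> \<longleftrightarrow> dyadic_right m j \<le> t \<and> t < dyadic_right m (Suc j)"
    using real by (simp add: dyadic_right_def ennreal_less_iff field_simps)
  finally show ?thesis .
qed (simp add: upper_dyadic_def)

lemma upper_dyadic_greater:
  assumes "t < \<infinity>"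
  shows "t < upper_dyadic m t"
proof -
  have "upper_dyadic m t = dyadic_right m (Suc (nat \<lfloor>enn2real t * 2 ^ m\<rfloor>))"
    using assms by (auto simp: upper_dyadic_def)
  then show ?thesis
    by (metis upper_dyadic_eq_iff)
qed

lemma upper_dyadic_tendsto:
  "(\<lambda>m. upper_dyadic m t) \<longlonglongrightarrow> t"
proof (cases t rule: ennreal_cases)
  case (real r)
  define y where "y m = real (Suc (nat \<lfloor>r * 2 ^ m\<rfloor>)) / 2 ^ m" for m
  have "y \<longlonglongrightarrow> r"
  proof (rule tendsto_sandwich)
    have b: "r \<le> y m" "y m \<le> r + (1/2) ^ m" for m
    proof -
      have "0 \<le> r * 2 ^ m" using real by simp
      then have f: "real (nat \<lfloor>r * 2 ^ m\<rfloor>) = of_int \<lfloor>r * 2 ^ m\<rfloor>" by simp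
      show "r \<le> y m"
        unfolding y_def of_nat_Suc f by (simp add: pos_le_divide_eq) linarith
      show "y m \<le> r + (1/2) ^ m"
        unfolding y_def of_nat_Suc f by (simp add: pos_divide_le_eq distrib_right power_one_over)
    qed
    show "eventually (\<lambda>m. r \<le> y m) sequentially" "eventually (\<lambda>m. y m \<le> r + (1/2) ^ m) sequentially"
      using b by auto
    have "(\<lambda>m. r + (1/2::real) ^ m) \<longlonglongrightarrow> r + 0"
      by (intro tendsto_intros LIMSEQ_power_zero) auto
    then show "(\<lambda>m. r + (1/2::real) ^ m) \<longlonglongrightarrow> r" by simp
  qed simp
  then have "(\<lambda>m. ennreal (y m)) \<longlonglongrightarrow> ennreal r"
    by (intro tendsto_ennrealI)
  moreover have "upper_dyadic m t = ennreal (y m)" for m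
    using real by (simp add: upper_dyadic_def dyadic_right_def y_def)
  ultimately show ?thesis
    using real by simp
qed simp

lemma upper_dyadic_at_right: "t < \<infinity> \<Longrightarrow> filterlim (\<lambda>m. upper_dyadic m t) (at_right t) sequentially"
  using upper_dyadic_tendsto[of t] upper_dyadic_greater[of t]
  by (auto simp: filterlim_at intro!: always_eventually less_imp_neq[THEN not_sym])

section \<open>Dyadic cells and their left end points\<close>

lemma dyadic_left_finite [simp]: "dyadic_left n k < top"
  by (auto simp: dyadic_left_def)

lemma dyadic_left_le_right: "dyadic_left n k \<le> dyadic_right n k"
  by (auto simp: dyadic_left_def dyadic_right_def intro!: ennreal_leI divide_right_mono)

lemma dyadic_cell_iff:
  assumes "T \<omega> = ennreal r" "0 \<le> r"
  shows "\<omega> \<in> dyadic_cell T n k \<longleftrightarrow> 0 < r \<and> int k = \<lceil>r * 2 ^ n\<rceil>"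
proof (cases k)
  case 0
  \<comment> \<open>The left end of cell 0 is truncated to 0, so cell 0 is empty. This is why
    \<open>0 < r\<close> appears in the equivalence: at \<open>r = 0\<close> the ceiling is 0 as
    well.\<close>
  have "ennreal (- 1 / 2 ^ n) = 0" by (intro ennreal_neg) simp
  moreover have "0 < \<lceil>r * 2 ^ n\<rceil>" if "0 < r"
    using that by (simp only: zero_less_ceiling) simp
  ultimately show ?thesis
    using 0 assms by (auto simp: dyadic_cell_def dyadic_left_def dyadic_right_def simp del: zero_less_ceiling)
next
  case (Suc j)
  have "\<omega> \<in> dyadic_cell T n k \<longleftrightarrow> real j < r * 2 ^ n \<and> r * 2 ^ n \<le> real j + 1"
    using Suc assms by (simp add: dyadic_cell_def dyadic_left_def dyadic_right_def ennreal_less_iff field_simps)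
  also have "\<dots> \<longleftrightarrow> int k = \<lceil>r * 2 ^ n\<rceil>"
    using Suc by (auto simp: eq_commute[of _ "\<lceil>_\<rceil>"] ceiling_eq_iff)
  also have "\<dots> \<longleftrightarrow> 0 < r \<and> int k = \<lceil>r * 2 ^ n\<rceil>"
    using Suc assms(2) by (cases "r = 0") auto
  finally show ?thesis .
qed

lemma dyadic_cell_unique:
  assumes "0 < T \<omega>" "T \<omega> < \<infinity>"
  shows "\<exists>!k. \<omega> \<in> dyadic_cell T n k"
proof -
  obtain r where r: "T \<omega> = ennreal r" "0 \<le> r"
    using assms by (cases "T \<omega>" rule: ennreal_cases) auto
  with assms have "0 < r" by simp
  then have "0 < r * 2 ^ n" by simp
  then have "0 < \<lceil>r * 2 ^ n\<rceil>" by (simp only: zero_less_ceiling)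
  then show ?thesis
    unfolding dyadic_cell_iff[of T, OF r] using \<open>0 < r\<close>
    by (intro ex1I[of _ "nat \<lceil>r * 2 ^ n\<rceil>"]) (auto intro: less_le_trans[of _ 0])
qed

lemma dyadic_index_cell: "0 < T \<omega> \<Longrightarrow> T \<omega> < \<infinity> \<Longrightarrow> \<omega> \<in> dyadic_cell T n (dyadic_index T n \<omega>)"
  unfolding dyadic_index_def by (rule theI') (rule dyadic_cell_unique)

lemma dyadic_cell_bounds: "\<omega> \<in> dyadic_cell T n k \<Longrightarrow> 0 < T \<omega> \<and> T \<omega> < \<infinity>"
  unfolding dyadic_cell_def using dyadic_right_finite(1)[of n k] by (auto intro: le_less_trans)

lemma dyadic_index_eq: "\<omega> \<in> dyadic_cell T n k \<Longrightarrow> dyadic_index T n \<omega> = k"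
  unfolding dyadic_index_def by (intro the1_equality dyadic_cell_unique) (auto dest: dyadic_cell_bounds)

text \<open>\<open>(k + 1) div 2\<close> is \<open>k / 2\<close> rounded up, as fits cells closed on
  the right. Refinement never moves the left end of the current cell backwards, so the information
  at left ends grows with \<open>n\<close>.\<close>

lemma dyadic_cell_Suc:
  assumes "\<omega> \<in> dyadic_cell T (Suc n) k"
  shows "\<omega> \<in> dyadic_cell T n ((k + 1) div 2)"
    "dyadic_left n ((k + 1) div 2) \<le> dyadic_left (Suc n) k"
proof -
  obtain r where r: "T \<omega> = ennreal r" "0 \<le> r"
    using dyadic_cell_bounds[OF assms] by (cases "T \<omega>" rule: ennreal_cases) auto
  have k: "0 < r" "int k = \<lceil>r * 2 ^ Suc n\<rceil>"
    using assms unfolding dyadic_cell_iff[of T, OF r] by auto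
  then have 1: "real k - 1 < r * 2 ^ n * 2" "r * 2 ^ n * 2 \<le> real k"
    by (auto simp: eq_commute[of _ "\<lceil>_\<rceil>"] ceiling_eq_iff algebra_simps)
  define j where "j = (k + 1) div 2"
  have j: "k = 2 * j \<or> k + 1 = 2 * j" unfolding j_def by linarith
  then have "int j = \<lceil>r * 2 ^ n\<rceil>"
    using 1 by (auto simp: eq_commute[of _ "\<lceil>_\<rceil>"] ceiling_eq_iff)
  then show "\<omega> \<in> dyadic_cell T n ((k + 1) div 2)"
    unfolding dyadic_cell_iff[of T, OF r] j_def[symmetric] using k by auto
  have "2 * (real j - 1) \<le> real k - 1" using j by auto
  then have "2 * (real j - 1) / 2 ^ Suc n \<le> (real k - 1) / 2 ^ Suc n"
    by (rule divide_right_mono) simp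
  moreover have "2 * (real j - 1) / 2 ^ Suc n = (real j - 1) / 2 ^ n"
    unfolding power_Suc by (rule mult_divide_mult_cancel_left) simp
  ultimately show "dyadic_left n ((k + 1) div 2) \<le> dyadic_left (Suc n) k"
    unfolding dyadic_left_def j_def[symmetric] by (intro ennreal_leI) simp
qed

text \<open>The cells are open on the left, so the left end stays strictly below \<open>T\<close>,
  at distance at most \<open>2^-n\<close>. A left limit at \<open>T\<close> can therefore be
  evaluated along these times.\<close>

lemma dyadic_left_at_left:
  assumes "0 < T \<omega>" "T \<omega> < \<infinity>"
  shows "filterlim (\<lambda>n. dyadic_left n (dyadic_index T n \<omega>)) (at_left (T \<omega>)) sequentially"
proof -
  obtain r where r: "T \<omega> = ennreal r" "0 \<le> r"
    using assms by (cases "T \<omega>" rule: ennreal_cases) auto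
  define y where "y n = (real (dyadic_index T n \<omega>) - 1) / 2 ^ n" for n
  have k: "int (dyadic_index T n \<omega>) = \<lceil>r * 2 ^ n\<rceil>" for n
    using dyadic_index_cell[of T, OF assms] unfolding dyadic_cell_iff[of T, OF r] by auto
  have b: "r - (1/2) ^ n \<le> y n" "y n < r" for n
  proof -
    have 1: "real (dyadic_index T n \<omega>) - 1 < r * 2 ^ n" "r * 2 ^ n \<le> real (dyadic_index T n \<omega>)"
      using k[of n] by (auto simp: eq_commute[of _ "\<lceil>_\<rceil>"] ceiling_eq_iff)
    show "y n < r"
      unfolding y_def using 1 by (simp add: pos_divide_less_eq)
    show "r - (1/2) ^ n \<le> y n"
      unfolding y_def using 1 by (simp add: pos_le_divide_eq left_diff_distrib power_one_over)
  qed
  have "y \<longlonglongrightarrow> r"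
  proof (rule tendsto_sandwich)
    show "eventually (\<lambda>n. r - (1/2) ^ n \<le> y n) sequentially" "eventually (\<lambda>n. y n \<le> r) sequentially"
      using b by (auto intro!: always_eventually less_imp_le)
    have "(\<lambda>n. r - (1/2::real) ^ n) \<longlonglongrightarrow> r - 0"
      by (intro tendsto_intros LIMSEQ_power_zero) auto
    then show "(\<lambda>n. r - (1/2::real) ^ n) \<longlonglongrightarrow> r" by simp
  qed simp
  then have "(\<lambda>n. ennreal (y n)) \<longlonglongrightarrow> T \<omega>"
    unfolding r by (intro tendsto_ennrealI)
  moreover have "dyadic_left n (dyadic_index T n \<omega>) < T \<omega>" for n
    using dyadic_index_cell[of T, OF assms, of n] by (auto simp: dyadic_cell_def)
  ultimately show ?thesis
    by (auto simp: filterlim_at dyadic_left_def y_def intro!: always_eventually less_imp_neq)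
qed

subsection \<open>Optional stopping for the density process\<close>

text \<open>With the truncated subtraction of \<open>ennreal\<close>, \<open>x - c\<close> is the
  excess of \<open>x\<close> over \<open>c\<close>; this splits an integrand into a bounded part and
  an excess.\<close>

lemma ennreal_min_plus_minus: "min x c + (x - c) = (x::ennreal)"
proof (cases "c \<le> x")
  case True
  then show ?thesis by (simp add: min_def add_diff_inverse_ennreal)
next
  case False
  then have "x < c" by simp
  moreover from this have "x - c = 0"
    by (intro diff_eq_0_ennreal less_imp_le) (auto intro: less_le_trans)
  ultimately show ?thesis by (simp add: min_absorb1 less_imp_le)
qed

lemma at_left_ennreal_neq_bot:
  fixes t :: ennreal
  assumes "0 < t"
  shows "at_left t \<noteq> bot"
proof
  assume "at_left t = bot"
  then have "eventually (\<lambda>_. False) (at_left t)" by simp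
  then obtain b where b: "b < t" "\<And>y. b < y \<Longrightarrow> y < t \<Longrightarrow> False"
    unfolding eventually_at_left[OF assms] by blast
  then show False using dense[OF b(1)] by blast
qed

lemma left_limit_eqI:
  assumes "(x \<longlongrightarrow> l) (at_left t)" "0 < t"
  shows "left_limit x t = l"
  using tendsto_Lim[OF at_left_ennreal_neq_bot[OF assms(2)] assms(1)] assms(2)
  by (auto simp: left_limit_def)

text \<open>
  Paths need not have left limits everywhere; the junk value of \<^const>\<open>left_limit\<close> is then a
  constant, which keeps \<open>{z\<^sub>T\<^sub>- = 0}\<close> measurable without completing the filtration.
\<close>

lemma left_limit_undefined:
  assumes "\<not> (\<exists>l. (x \<longlongrightarrow> l) (at_left t))" "0 < t"
  shows "left_limit x t = (THE l. False)"
proof -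
  have "(\<lambda>l. (x \<longlongrightarrow> l) (at_left t)) = (\<lambda>l. False)"
    using assms(1) by auto
  then show ?thesis
    using assms(2) by (auto simp: left_limit_def Topological_Spaces.Lim_def)
qed

text \<open>Both sides have the same integrals over the sets of \<open>F\<close>. The nonnegative
  form admits arbitrary nonnegative test functions without integrability conditions, which is how
  quotients of conditional expectations are treated.\<close>

lemma (in sigma_finite_subalgebra) nn_cond_exp_eq_real_cond_exp:
  assumes f: "integrable M f" "AE x in M. 0 \<le> f x"
  shows "AE x in M. ennreal (real_cond_exp M F f x) = nn_cond_exp M F (\<lambda>x. ennreal (f x)) x"
proof (rule nn_cond_exp_charact)
  have [measurable]: "f \<in> borel_measurable M" using f by auto
  have pos: "AE x in M. 0 \<le> real_cond_exp M F f x"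
    using f by (intro real_cond_exp_pos) auto
  fix A assume A[measurable]: "A \<in> sets F"
  have AM[measurable]: "A \<in> sets M" using A subalg by (auto simp: subalgebra_def)
  have eq: "(\<integral>\<^sup>+x\<in>A. ennreal (g x) \<partial>M) = ennreal (\<integral>x\<in>A. g x \<partial>M)"
    if g: "integrable M g" "AE x in M. 0 \<le> g x" for g :: "'a \<Rightarrow> real"
  proof -
    have "(\<integral>\<^sup>+x\<in>A. ennreal (g x) \<partial>M) = (\<integral>\<^sup>+x. ennreal (indicator A x * g x) \<partial>M)"
      by (intro nn_integral_cong) (auto simp: indicator_def)
    also have "\<dots> = ennreal (\<integral>x. indicator A x * g x \<partial>M)"
      using integrable_mult_indicator[OF AM g(1)] g(2)
      by (intro nn_integral_eq_integral) (auto simp: indicator_def)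
    finally show ?thesis
      by (simp add: set_lebesgue_integral_def)
  qed
  show "(\<integral>\<^sup>+x\<in>A. ennreal (f x) \<partial>M) = (\<integral>\<^sup>+x\<in>A. ennreal (real_cond_exp M F f x) \<partial>M)"
    unfolding eq[OF f] eq[OF real_cond_exp_int(1)[OF f(1)] pos] real_cond_exp_intA[OF f(1) A] ..
qed (use f in measurable)

lemma (in sigma_finite_subalgebra) real_cond_exp_nn_intg:
  assumes f: "integrable M f" "AE x in M. 0 \<le> f x" and g[measurable]: "g \<in> borel_measurable F"
  shows "(\<integral>\<^sup>+x. g x * ennreal (real_cond_exp M F f x) \<partial>M) = (\<integral>\<^sup>+x. g x * ennreal (f x) \<partial>M)"
proof -
  have [measurable]: "f \<in> borel_measurable M" using f by auto
  have "(\<integral>\<^sup>+x. g x * ennreal (real_cond_exp M F f x) \<partial>M) = (\<integral>\<^sup>+x. g x * nn_cond_exp M F (\<lambda>x. ennreal (f x)) x \<partial>M)"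
    using nn_cond_exp_eq_real_cond_exp[OF f] by (intro nn_integral_cong_AE) auto
  also have "\<dots> = (\<integral>\<^sup>+x. g x * ennreal (f x) \<partial>M)"
    by (intro nn_cond_exp_intg) measurable
  finally show ?thesis .
qed

text \<open>\<open>L\<close> is not assumed to be contained in \<open>N\<close>; only its traces on
  \<open>S\<close> are. This is the situation on a dyadic cell, where the strict past knows what
  happened up to the left end, and on \<open>{T = \<infinity>}\<close>, where it knows
  everything.\<close>

lemma borel_measurable_If_subset:
  fixes f :: "'a \<Rightarrow> real"
  assumes f: "f \<in> borel_measurable L" and "space L = space N" and S: "S \<inter> space N \<in> sets N"
    and trace: "\<And>A. A \<in> sets L \<Longrightarrow> A \<inter> S \<in> sets N"
  shows "(\<lambda>x. if x \<in> S then f x else 0) \<in> borel_measurable N"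
proof (rule measurableI)
  fix B :: "real set" assume B: "B \<in> sets borel"
  have "(f -` B \<inter> space L) \<inter> S \<in> sets N"
    using f B by (intro trace measurable_sets)
  \<comment> \<open>Outside \<open>S\<close> the function is 0, so the complement of
    \<open>S\<close> enters the preimage exactly if \<open>0 \<in> B\<close>.\<close>
  moreover have "(if 0 \<in> B then space N - S \<inter> space N else {}) \<in> sets N"
    using S by auto
  ultimately have "(f -` B \<inter> space L) \<inter> S \<union> (if 0 \<in> B then space N - S \<inter> space N else {}) \<in> sets N"
    by (rule sets.Un)
  also have "(f -` B \<inter> space L) \<inter> S \<union> (if 0 \<in> B then space N - S \<inter> space N else {})
      = (\<lambda>x. if x \<in> S then f x else 0) -` B \<inter> space N"
    using assms(2) by (auto split: if_splits)
  finally show "(\<lambda>x. if x \<in> S then f x else 0) -` B \<inter> space N \<in> sets N" .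
qed simp

lemma sets_restrict_Diff:
  assumes "S \<inter> B \<in> sets (restrict_space M S)"
  shows "S \<inter> (space M - B) \<in> sets (restrict_space M S)"
proof -
  have "S \<inter> (space M - B) = space (restrict_space M S) - S \<inter> B"
    by (auto simp: space_restrict_space)
  then show ?thesis using sets.compl_sets[OF assms] by simp
qed

lemma sets_restrict_UN:
  fixes B :: "nat \<Rightarrow> 'b set"
  assumes "\<And>i. S \<inter> B i \<in> sets (restrict_space M S)"
  shows "S \<inter> (\<Union>i. B i) \<in> sets (restrict_space M S)"
proof -
  have "(\<Union>i. S \<inter> B i) \<in> sets (restrict_space M S)"
    using assms by (intro sets.countable_nat_UN) auto
  then show ?thesis by simp
qed

section \<open>The density process as a martingale\<close>

locale density_filtration =
  P: prob_space P + mu: prob_space \<mu> + filtration "space P" F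
  for P \<mu> :: "'a measure" and F :: "ennreal \<Rightarrow> 'a measure" +
  fixes z :: "ennreal \<Rightarrow> 'a \<Rightarrow> real" and T :: "'a \<Rightarrow> ennreal"
  assumes sets_mu: "sets \<mu> = sets P"
    and ac: "absolutely_continuous P \<mu>"
    and sets_P_generated: "sets P = sigma_sets (space P) (\<Union>t\<in>{..<\<infinity>}. sets (F t))"
    and sets_F_infinity: "sets (F \<infinity>) = sets P"
    and density: "density_process P \<mu> F z"
    and stopping: "stopping_time F T"
begin

lemma space_mu: "space \<mu> = space P"
  using sets_mu by (rule sets_eq_imp_space_eq)

lemma sets_F_subset: "sets (F t) \<subseteq> sets P"
  using sets_F_mono[of t \<infinity>] sets_F_infinity by simp

lemma subalgebra_P_F: "subalgebra P (F t)"
  using sets_F_subset by (simp add: subalgebra_def space_F)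

lemma sigma_finite_subalgebra_P_F: "sigma_finite_subalgebra P (F t)"
  using subalgebra_P_F by (rule P.sigma_finite_subalgebraI)

lemma subalgebra_mu_F: "subalgebra \<mu> (F t)"
  using sets_F_subset by (simp add: subalgebra_def space_F space_mu sets_mu)

lemma z_measurable_F [measurable]: "z t \<in> borel_measurable (F t)"
  using density by (simp add: density_process_def)

lemma z_measurable [measurable]: "z t \<in> borel_measurable P"
  using measurable_from_subalg[OF subalgebra_P_F z_measurable_F] .

lemma z_right_continuous: "\<omega> \<in> space P \<Longrightarrow> t < \<infinity> \<Longrightarrow> continuous (at_right t) (\<lambda>s. z s \<omega>)"
  using density by (simp add: density_process_def)

lemma z_nonneg: "AE \<omega> in P. 0 \<le> z t \<omega>"
proof -
  have "AE \<omega> in P. z t \<omega> =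
        enn2real (RN_deriv (restr_to_subalg P (F t)) (restr_to_subalg \<mu> (F t)) \<omega>)"
    using density by (simp add: density_process_def)
  then show ?thesis
    by eventually_elim simp
qed

lemma z_nn_integral:
  assumes A[measurable]: "A \<in> sets (F t)"
  shows "(\<integral>\<^sup>+\<omega>. ennreal (z t \<omega>) * indicator A \<omega> \<partial>P) = emeasure \<mu> A"
proof -
  let ?P = "restr_to_subalg P (F t)" and ?\<mu> = "restr_to_subalg \<mu> (F t)"
  interpret RP: prob_space ?P
    by (intro prob_space_restr_to_subalg subalgebra_P_F P.prob_space_axioms)
  interpret Rmu: prob_space ?\<mu>
    by (intro prob_space_restr_to_subalg subalgebra_mu_F mu.prob_space_axioms)
  have sets: "sets ?\<mu> = sets ?P"
    by (simp add: sets_restr_to_subalg[OF subalgebra_P_F] sets_restr_to_subalg[OF subalgebra_mu_F])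
  have acR: "absolutely_continuous ?P ?\<mu>"
    using ac unfolding absolutely_continuous_def null_sets_restr_to_subalg[OF subalgebra_P_F]
      null_sets_restr_to_subalg[OF subalgebra_mu_F] by auto
  have AP[measurable]: "A \<in> sets P" using A sets_F_subset[of t] by auto
  have A': "A \<in> sets ?P"
    using A by (simp add: sets_restr_to_subalg[OF subalgebra_P_F])
  have RN[measurable]: "RN_deriv ?P ?\<mu> \<in> borel_measurable (F t)"
    by (rule measurable_in_subalg'[OF subalgebra_P_F borel_measurable_RN_deriv])
  \<comment> \<open>\<open>z\<close> is real-valued and \<open>enn2real\<close> sends
    \<open>\<infinity>\<close> to 0, so finiteness of the derivative is what keeps its mass.\<close>
  have "AE \<omega> in ?P. RN_deriv ?P ?\<mu> \<omega> \<noteq> \<infinity>"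
    by (rule RP.RN_deriv_finite[OF Rmu.sigma_finite_measure_axioms acR sets])
  then have "AE \<omega> in P. RN_deriv ?P ?\<mu> \<omega> \<noteq> \<infinity>"
    by (rule AE_restr_to_subalg[OF subalgebra_P_F])
  moreover have "AE \<omega> in P. z t \<omega> = enn2real (RN_deriv ?P ?\<mu> \<omega>)"
    using density by (simp add: density_process_def)
  ultimately have "AE \<omega> in P. ennreal (z t \<omega>) * indicator A \<omega> = RN_deriv ?P ?\<mu> \<omega> * indicator A \<omega>"
    by eventually_elim (simp add: less_top)
  then have "(\<integral>\<^sup>+\<omega>. ennreal (z t \<omega>) * indicator A \<omega> \<partial>P) = (\<integral>\<^sup>+\<omega>. RN_deriv ?P ?\<mu> \<omega> * indicator A \<omega> \<partial>P)"
    by (rule nn_integral_cong_AE)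
  also have "\<dots> = (\<integral>\<^sup>+\<omega>. RN_deriv ?P ?\<mu> \<omega> * indicator A \<omega> \<partial>?P)"
    by (intro nn_integral_subalgebra2[symmetric] subalgebra_P_F) measurable
  also have "\<dots> = emeasure (density ?P (RN_deriv ?P ?\<mu>)) A"
    using A' by (simp add: emeasure_density)
  also have "\<dots> = emeasure ?\<mu> A"
    by (simp add: RP.density_RN_deriv[OF acR sets])
  also have "\<dots> = emeasure \<mu> A"
    by (rule emeasure_restr_to_subalg[OF subalgebra_mu_F A])
  finally show ?thesis .
qed

lemma integrable_density:
  assumes [measurable]: "f \<in> borel_measurable P" and "AE \<omega> in P. 0 \<le> f \<omega>"
    and "(\<integral>\<^sup>+\<omega>. ennreal (f \<omega>) * indicator (space P) \<omega> \<partial>P) = emeasure \<mu> (space P)"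
  shows "integrable P f"
proof (rule integrableI_nonneg)
  have "(\<integral>\<^sup>+\<omega>. ennreal (f \<omega>) \<partial>P) = (\<integral>\<^sup>+\<omega>. ennreal (f \<omega>) * indicator (space P) \<omega> \<partial>P)"
    by (intro nn_integral_cong) simp
  also have "\<dots> < \<infinity>"
    using assms(3) mu.emeasure_space_1 by (simp add: space_mu)
  finally show "(\<integral>\<^sup>+\<omega>. ennreal (f \<omega>) \<partial>P) < \<infinity>" .
qed (use assms in auto)

lemma set_integral_density:
  assumes "f \<in> borel_measurable P" "AE \<omega> in P. 0 \<le> f \<omega>" "A \<in> sets P"
    and "(\<integral>\<^sup>+\<omega>. ennreal (f \<omega>) * indicator A \<omega> \<partial>P) = emeasure \<mu> A"
  shows "(\<integral>\<omega>\<in>A. f \<omega> \<partial>P) = measure \<mu> A"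
proof -
  note [measurable] = assms(1,3)
  have "(\<integral>\<omega>\<in>A. f \<omega> \<partial>P) = enn2real (\<integral>\<^sup>+\<omega>. ennreal (indicator A \<omega> * f \<omega>) \<partial>P)"
    unfolding set_lebesgue_integral_def real_scaleR_def
    using assms(2) by (intro integral_eq_nn_integral) (measurable, auto)
  also have "(\<integral>\<^sup>+\<omega>. ennreal (indicator A \<omega> * f \<omega>) \<partial>P) = (\<integral>\<^sup>+\<omega>. ennreal (f \<omega>) * indicator A \<omega> \<partial>P)"
    by (intro nn_integral_cong) (simp add: indicator_def)
  finally show ?thesis
    using assms(4) by (simp add: measure_def)
qed

lemma z_integrable [intro]: "integrable P (z t)"
  using z_nn_integral[of "space P" t] sets.top[of "F t"]
  by (intro integrable_density z_nonneg) (auto simp: space_F)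

lemma z_set_integral: "A \<in> sets (F t) \<Longrightarrow> (\<integral>\<omega>\<in>A. z t \<omega> \<partial>P) = measure \<mu> A"
  using sets_F_subset[of t] by (intro set_integral_density z_nonneg z_nn_integral) auto

text \<open>Over an event of \<open>F t\<close>, both \<open>z t\<close> and
  \<open>z \<infinity>\<close> integrate to its \<open>\<mu>\<close>-measure.\<close>

lemma z_eq_cond_exp: "AE \<omega> in P. z t \<omega> = real_cond_exp P (F t) (z \<infinity>) \<omega>"
proof -
  interpret sigma_finite_subalgebra P "F t" by (rule sigma_finite_subalgebra_P_F)
  have "AE \<omega> in P. real_cond_exp P (F t) (z \<infinity>) \<omega> = z t \<omega>"
  proof (rule real_cond_exp_charact)
    fix A assume A: "A \<in> sets (F t)"
    then have "A \<in> sets (F \<infinity>)" using sets_F_mono[of t \<infinity>] by auto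
    with A show "(\<integral>\<omega>\<in>A. z \<infinity> \<omega> \<partial>P) = (\<integral>\<omega>\<in>A. z t \<omega> \<partial>P)"
      by (simp only: z_set_integral)
  qed auto
  then show ?thesis by eventually_elim simp
qed

lemma T_measurable [measurable]: "T \<in> borel_measurable P"
  using stopping by (rule measurable_stopping_time) (auto simp: space_F intro: subsetD[OF sets_F_subset])

lemma sets_pre_sigma_P: "C \<in> sets (pre_sigma T) \<Longrightarrow> C \<in> sets P"
  using sets_pre_sigmaD[OF stopping, of C \<infinity>] sets_F_infinity by simp

lemma sets_pre_sigma_less:
  assumes "C \<in> sets (pre_sigma T)" "s \<le> t"
  shows "{\<omega>\<in>C. T \<omega> < s} \<in> sets (F t)"
proof -
  have "{\<omega>\<in>C. T \<omega> \<le> s} \<inter> {\<omega>\<in>space (F s). T \<omega> < s} \<in> sets (F s)"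
    using sets_pre_sigmaD[OF stopping assms(1)] stopping_time_less_const[OF stopping, of s]
    by (auto simp: pred_def)
  also have "{\<omega>\<in>C. T \<omega> \<le> s} \<inter> {\<omega>\<in>space (F s). T \<omega> < s} = {\<omega>\<in>C. T \<omega> < s}"
    using sets.sets_into_space[OF sets_pre_sigma_P[OF assms(1)]] by (auto simp: space_F)
  finally show ?thesis
    using sets_F_mono[OF assms(2)] by auto
qed

section \<open>Optional stopping along discretised times\<close>

definition dyadic_times :: "nat \<Rightarrow> ennreal set" where
  "dyadic_times m = insert \<infinity> (range (\<lambda>j. dyadic_right m (Suc j)))"

lemma countable_dyadic_times: "countable (dyadic_times m)"
  by (simp add: dyadic_times_def)

lemma upper_dyadic_dyadic_times: "upper_dyadic m t \<in> dyadic_times m"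
  using upper_dyadic_range by (simp add: dyadic_times_def)

text \<open>For finite \<open>u\<close> the discretised time equals \<open>u\<close> on a difference
  of two events of the form \<open>T < s\<close> with \<open>s \<le> u\<close>, and their
  intersections with \<open>C\<close> are known at \<open>u\<close>.\<close>

lemma pre_sigma_upper_dyadic:
  assumes C: "C \<in> sets (pre_sigma T)" and u: "u \<in> dyadic_times m"
  shows "{\<omega>\<in>C. upper_dyadic m (T \<omega>) = u} \<in> sets (F u)"
proof (cases "u = \<infinity>")
  case True
  note [measurable] = sets_pre_sigma_P[OF C]
  have "{\<omega>\<in>space P. \<omega> \<in> C \<and> T \<omega> = \<infinity>} \<in> sets P"
    by measurable
  also have "{\<omega>\<in>space P. \<omega> \<in> C \<and> T \<omega> = \<infinity>} = {\<omega>\<in>C. upper_dyadic m (T \<omega>) = u}"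
    using sets.sets_into_space[OF sets_pre_sigma_P[OF C]] True upper_dyadic_eq_infinity[of m] by auto
  finally show ?thesis
    using True sets_F_infinity by simp
next
  case False
  then obtain j where j: "u = dyadic_right m (Suc j)"
    using u by (auto simp: dyadic_times_def)
  have "dyadic_right m j \<le> u"
    unfolding j dyadic_right_def by (intro ennreal_leI divide_right_mono) auto
  then have "{\<omega>\<in>C. T \<omega> < u} - {\<omega>\<in>C. T \<omega> < dyadic_right m j} \<in> sets (F u)"
    using C by (intro sets.Diff sets_pre_sigma_less) auto
  also have "{\<omega>\<in>C. T \<omega> < u} - {\<omega>\<in>C. T \<omega> < dyadic_right m j} = {\<omega>\<in>C. upper_dyadic m (T \<omega>) = u}"
    unfolding j upper_dyadic_eq_iff by auto
  finally show ?thesis .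
qed

lemma space_in_pre_sigma: "space P \<in> sets (pre_sigma T)"
  using sets.top[of "pre_sigma T"] by (simp add: space_pre_sigma)

definition z_upper :: "nat \<Rightarrow> 'a \<Rightarrow> real" where
  "z_upper m \<omega> = z (upper_dyadic m (T \<omega>)) \<omega>"

definition z_stopped :: "'a \<Rightarrow> real" where
  "z_stopped \<omega> = z (T \<omega>) \<omega>"

lemma z_upper_measurable [measurable]: "z_upper m \<in> borel_measurable P"
proof -
  have g: "(\<lambda>\<omega>. upper_dyadic m (T \<omega>)) \<in> P \<rightarrow>\<^sub>M count_space (dyadic_times m)"
    unfolding measurable_count_space_eq_countable[OF countable_dyadic_times]
  proof (intro conjI ballI)
    fix u assume "u \<in> dyadic_times m"
    from pre_sigma_upper_dyadic[OF space_in_pre_sigma this]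
    have "{\<omega>\<in>space P. upper_dyadic m (T \<omega>) = u} \<in> sets P"
      using sets_F_subset by auto
    also have "{\<omega>\<in>space P. upper_dyadic m (T \<omega>) = u} = (\<lambda>\<omega>. upper_dyadic m (T \<omega>)) -` {u} \<inter> space P"
      by auto
    finally show "(\<lambda>\<omega>. upper_dyadic m (T \<omega>)) -` {u} \<inter> space P \<in> sets P" .
  qed (use upper_dyadic_dyadic_times in auto)
  show ?thesis
    unfolding z_upper_def[abs_def]
    by (rule measurable_compose_countable'[where f=z, OF z_measurable g countable_dyadic_times])
qed

lemma z_upper_tendsto:
  assumes "\<omega> \<in> space P"
  shows "(\<lambda>m. z_upper m \<omega>) \<longlonglongrightarrow> z_stopped \<omega>"
proof (cases "T \<omega> < \<infinity>")
  case True
  have "((\<lambda>s. z s \<omega>) \<longlongrightarrow> z (T \<omega>) \<omega>) (at_right (T \<omega>))"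
    using z_right_continuous[OF assms True] by (simp add: continuous_within)
  then show ?thesis
    unfolding z_upper_def z_stopped_def by (rule filterlim_compose) (rule upper_dyadic_at_right[OF True])
next
  case False
  then have "T \<omega> = top" by (simp add: less_top[symmetric])
  then show ?thesis
    by (simp add: z_upper_def z_stopped_def)
qed

lemma z_stopped_measurable [measurable]: "z_stopped \<in> borel_measurable P"
  by (rule borel_measurable_LIMSEQ_real[OF z_upper_tendsto]) auto

lemma z_upper_nonneg: "AE \<omega> in P. \<forall>m. 0 \<le> z_upper m \<omega>"
  unfolding AE_all_countable
proof
  fix m
  \<comment> \<open>The discretised time takes countably many values, so one null set serves all of
    them.\<close>
  have "AE \<omega> in P. \<forall>u\<in>dyadic_times m. 0 \<le> z u \<omega>"
    unfolding AE_ball_countable[OF countable_dyadic_times] by (intro ballI z_nonneg)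
  then show "AE \<omega> in P. 0 \<le> z_upper m \<omega>"
    by eventually_elim (simp add: z_upper_def upper_dyadic_dyadic_times)
qed

lemma z_stopped_nonneg: "AE \<omega> in P. 0 \<le> z_stopped \<omega>"
  using z_upper_nonneg AE_space
proof eventually_elim
  case (elim \<omega>)
  then show ?case
    by (intro LIMSEQ_le_const[OF z_upper_tendsto]) auto
qed

text \<open>Where the discretised time equals \<open>u\<close>, this is the density property of
  \<open>z u\<close>. \<open>D\<close> ranges over the past of the discretised time rather than that
  of \<open>T\<close>, because it will be cut out by a condition on \<open>z_upper\<close>
  itself.\<close>

lemma z_upper_nn_integral:
  assumes D: "D \<in> sets P" "\<And>u. u \<in> dyadic_times m \<Longrightarrow> {\<omega>\<in>D. upper_dyadic m (T \<omega>) = u} \<in> sets (F u)"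
  shows "(\<integral>\<^sup>+\<omega>. ennreal (z_upper m \<omega>) * indicator D \<omega> \<partial>P) = emeasure \<mu> D"
proof -
  let ?\<nu> = "density P (\<lambda>\<omega>. ennreal (z_upper m \<omega>))"
  let ?D = "\<lambda>u. {\<omega>\<in>D. upper_dyadic m (T \<omega>) = u}"
  have D_eq: "D = (\<Union>u\<in>dyadic_times m. ?D u)"
    using upper_dyadic_dyadic_times by auto
  have D': "?D u \<in> sets P" if "u \<in> dyadic_times m" for u
    using D(2)[OF that] sets_F_subset[of u] by auto
  have disj: "disjoint_family_on ?D (dyadic_times m)"
    by (auto simp: disjoint_family_on_def)
  have "(\<integral>\<^sup>+\<omega>. ennreal (z_upper m \<omega>) * indicator D \<omega> \<partial>P) = emeasure ?\<nu> (\<Union>u\<in>dyadic_times m. ?D u)"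
    unfolding D_eq[symmetric] using D(1) by (simp add: emeasure_density)
  also have "\<dots> = (\<integral>\<^sup>+u. emeasure ?\<nu> (?D u) \<partial>count_space (dyadic_times m))"
    using D' by (intro emeasure_UN_countable countable_dyadic_times disj) auto
  also have "\<dots> = (\<integral>\<^sup>+u. emeasure \<mu> (?D u) \<partial>count_space (dyadic_times m))"
  proof (intro nn_integral_cong)
    fix u assume "u \<in> space (count_space (dyadic_times m))"
    then have u: "u \<in> dyadic_times m" by simp
    have "emeasure ?\<nu> (?D u) = (\<integral>\<^sup>+\<omega>. ennreal (z_upper m \<omega>) * indicator (?D u) \<omega> \<partial>P)"
      using D'[OF u] by (simp add: emeasure_density)
    also have "\<dots> = (\<integral>\<^sup>+\<omega>. ennreal (z u \<omega>) * indicator (?D u) \<omega> \<partial>P)"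
      by (intro nn_integral_cong) (auto simp: z_upper_def indicator_def)
    also have "\<dots> = emeasure \<mu> (?D u)"
      by (rule z_nn_integral[OF D(2)[OF u]])
    finally show "emeasure ?\<nu> (?D u) = emeasure \<mu> (?D u)" .
  qed
  also have "\<dots> = emeasure \<mu> (\<Union>u\<in>dyadic_times m. ?D u)"
    using D' by (intro emeasure_UN_countable[symmetric] countable_dyadic_times disj) (auto simp: sets_mu)
  also have "\<dots> = emeasure \<mu> D"
    unfolding D_eq[symmetric] ..
  finally show ?thesis .
qed

text \<open>
  The conditional Jensen inequality for \<open>x \<mapsto> (x - c)\<^sup>+\<close>. It replaces uniform integrability
  when passing to the limit in the optional stopping identity.
\<close>

lemma z_upper_excess:
  assumes C: "C \<in> sets (pre_sigma T)"
  shows "(\<integral>\<^sup>+\<omega>. (ennreal (z_upper m \<omega>) - ennreal c) * indicator C \<omega> \<partial>P) \<le> (\<integral>\<^sup>+\<omega>. ennreal (z \<infinity> \<omega>) - ennreal c \<partial>P)"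
proof -
  note CP[measurable] = sets_pre_sigma_P[OF C]
  define D where "D = {\<omega>\<in>space P. \<omega> \<in> C \<and> ennreal c < ennreal (z_upper m \<omega>)}"
  have D[measurable]: "D \<in> sets P"
    unfolding D_def by measurable
  have DF: "{\<omega>\<in>D. upper_dyadic m (T \<omega>) = u} \<in> sets (F u)" if u: "u \<in> dyadic_times m" for u
  proof -
    note [measurable] = pre_sigma_upper_dyadic[OF C u]
    have "{\<omega>\<in>space (F u). \<omega> \<in> {\<omega>\<in>C. upper_dyadic m (T \<omega>) = u} \<and> ennreal c < ennreal (z u \<omega>)} \<in> sets (F u)"
      by measurable
    also have "{\<omega>\<in>space (F u). \<omega> \<in> {\<omega>\<in>C. upper_dyadic m (T \<omega>) = u} \<and> ennreal c < ennreal (z u \<omega>)}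
      = {\<omega>\<in>D. upper_dyadic m (T \<omega>) = u}"
      by (auto simp: D_def space_F z_upper_def)
    finally show ?thesis .
  qed
  let ?e = "ennreal c * emeasure P D"
  have fin: "?e \<noteq> top"
    by (simp add: P.emeasure_eq_measure ennreal_mult_eq_top_iff)
  have "?e + (\<integral>\<^sup>+\<omega>. (ennreal (z_upper m \<omega>) - ennreal c) * indicator C \<omega> \<partial>P)
      = (\<integral>\<^sup>+\<omega>. ennreal c * indicator D \<omega> + (ennreal (z_upper m \<omega>) - ennreal c) * indicator C \<omega> \<partial>P)"
    by (simp add: nn_integral_add nn_integral_cmult_indicator)
  \<comment> \<open>On \<open>C\<close> the excess vanishes outside \<open>D\<close>, and on
    \<open>D\<close> adding \<open>c\<close> restores \<open>z_upper\<close>.\<close>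
  also have "\<dots> = (\<integral>\<^sup>+\<omega>. ennreal (z_upper m \<omega>) * indicator D \<omega> \<partial>P)"
    using sets.sets_into_space[OF CP]
    by (intro nn_integral_cong)
      (auto simp: D_def indicator_def add_diff_inverse_ennreal diff_eq_0_ennreal not_less)
  also have "\<dots> = emeasure \<mu> D"
    by (rule z_upper_nn_integral[OF D DF])
  also have "\<dots> = (\<integral>\<^sup>+\<omega>. ennreal (z \<infinity> \<omega>) * indicator D \<omega> \<partial>P)"
    using D sets_F_infinity by (intro z_nn_integral[symmetric]) simp
  also have "\<dots> \<le> (\<integral>\<^sup>+\<omega>. ennreal c * indicator D \<omega> + (ennreal (z \<infinity> \<omega>) - ennreal c) \<partial>P)"
  proof (rule nn_integral_mono)
    fix \<omega>
    have "ennreal (z \<infinity> \<omega>) \<le> ennreal c + (ennreal (z \<infinity> \<omega>) - ennreal c)"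
      using add_right_mono[OF min.cobounded2[of "ennreal (z \<infinity> \<omega>)" "ennreal c"], of "ennreal (z \<infinity> \<omega>) - ennreal c"]
      by (simp only: ennreal_min_plus_minus)
    then show "ennreal (z \<infinity> \<omega>) * indicator D \<omega> \<le> ennreal c * indicator D \<omega> + (ennreal (z \<infinity> \<omega>) - ennreal c)"
      by (simp add: indicator_def)
  qed
  also have "\<dots> = ?e + (\<integral>\<^sup>+\<omega>. ennreal (z \<infinity> \<omega>) - ennreal c \<partial>P)"
    by (simp add: nn_integral_add nn_integral_cmult_indicator)
  finally show ?thesis
    using fin by (simp add: ennreal_add_left_cancel_le)
qed

lemma z_infinity_excess_tendsto: "(\<lambda>n. \<integral>\<^sup>+\<omega>. ennreal (z \<infinity> \<omega>) - ennreal (real n) \<partial>P) \<longlonglongrightarrow> 0"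
proof -
  have "(\<lambda>n. \<integral>\<^sup>+\<omega>. ennreal (z \<infinity> \<omega>) - ennreal (real n) \<partial>P) \<longlonglongrightarrow> (\<integral>\<^sup>+\<omega>. 0 \<partial>P)"
  proof (rule nn_integral_dominated_convergence[where w="\<lambda>\<omega>. ennreal (z \<infinity> \<omega>)"])
    show "AE \<omega> in P. (\<lambda>n. ennreal (z \<infinity> \<omega>) - ennreal (real n)) \<longlonglongrightarrow> 0"
    proof (intro AE_I2 tendsto_eventually)
      fix \<omega>
      obtain N :: nat where "z \<infinity> \<omega> \<le> real N" using real_arch_simple by blast
      then show "\<forall>\<^sub>F n in sequentially. ennreal (z \<infinity> \<omega>) - ennreal (real n) = 0"
        by (intro eventually_sequentiallyI[of N] diff_eq_0_ennreal ennreal_leI) (auto intro: order_trans)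
    qed
    have "(\<integral>\<^sup>+\<omega>. ennreal (z \<infinity> \<omega>) \<partial>P) = (\<integral>\<^sup>+\<omega>. ennreal (z \<infinity> \<omega>) * indicator (space P) \<omega> \<partial>P)"
      by (intro nn_integral_cong) simp
    also have "\<dots> = emeasure \<mu> (space P)"
      using sets_F_infinity by (intro z_nn_integral) simp
    finally show "(\<integral>\<^sup>+\<omega>. ennreal (z \<infinity> \<omega>) \<partial>P) < \<infinity>"
      using mu.emeasure_space_1 by (simp add: space_mu)
  qed (auto simp: diff_le_self_ennreal)
  then show ?thesis by simp
qed

text \<open>Fatou's lemma gives one inequality. For the other, the mass that might be lost sits in
  the excess of \<open>z_upper\<close> over a level \<open>n\<close>; it is bounded, uniformly in
  \<open>m\<close>, by the excess of \<open>z \<infinity>\<close>, which vanishes as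
  \<open>n\<close> grows. The truncated part converges by domination.\<close>

lemma z_stopped_nn_integral:
  assumes C: "C \<in> sets (pre_sigma T)"
  shows "(\<integral>\<^sup>+\<omega>. ennreal (z_stopped \<omega>) * indicator C \<omega> \<partial>P) = emeasure \<mu> C"
proof (rule antisym)
  note CP[measurable] = sets_pre_sigma_P[OF C]
  have I: "(\<integral>\<^sup>+\<omega>. ennreal (z_upper m \<omega>) * indicator C \<omega> \<partial>P) = emeasure \<mu> C" for m
    by (intro z_upper_nn_integral CP pre_sigma_upper_dyadic[OF C])
  have lim: "(\<lambda>m. ennreal (z_upper m \<omega>) * indicator C \<omega>) \<longlonglongrightarrow> ennreal (z_stopped \<omega>) * indicator C \<omega>"
    if "\<omega> \<in> space P" for \<omega>
    using tendsto_ennrealI[OF z_upper_tendsto[OF that]] by (cases "\<omega> \<in> C") auto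
  have "(\<integral>\<^sup>+\<omega>. ennreal (z_stopped \<omega>) * indicator C \<omega> \<partial>P)
      = (\<integral>\<^sup>+\<omega>. liminf (\<lambda>m. ennreal (z_upper m \<omega>) * indicator C \<omega>) \<partial>P)"
    using lim_imp_Liminf[OF sequentially_bot lim] by (intro nn_integral_cong) simp
  also have "\<dots> \<le> liminf (\<lambda>m. \<integral>\<^sup>+\<omega>. ennreal (z_upper m \<omega>) * indicator C \<omega> \<partial>P)"
    by (intro nn_integral_liminf) measurable
  finally show "(\<integral>\<^sup>+\<omega>. ennreal (z_stopped \<omega>) * indicator C \<omega> \<partial>P) \<le> emeasure \<mu> C"
    unfolding I by (simp add: Liminf_const)
  have bound: "emeasure \<mu> C \<le> (\<integral>\<^sup>+\<omega>. ennreal (z_stopped \<omega>) * indicator C \<omega> \<partial>P)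
      + (\<integral>\<^sup>+\<omega>. ennreal (z \<infinity> \<omega>) - ennreal (real n) \<partial>P)" for n
  proof -
    let ?c = "ennreal (real n)"
    let ?d = "\<integral>\<^sup>+\<omega>. ennreal (z \<infinity> \<omega>) - ?c \<partial>P"
    have le: "emeasure \<mu> C \<le> (\<integral>\<^sup>+\<omega>. min (ennreal (z_upper m \<omega>)) ?c * indicator C \<omega> \<partial>P) + ?d" for m
    proof -
      have "emeasure \<mu> C = (\<integral>\<^sup>+\<omega>. min (ennreal (z_upper m \<omega>)) ?c * indicator C \<omega>
          + (ennreal (z_upper m \<omega>) - ?c) * indicator C \<omega> \<partial>P)"
        unfolding I[symmetric, of m] distrib_right[symmetric] ennreal_min_plus_minus ..
      also have "\<dots> = (\<integral>\<^sup>+\<omega>. min (ennreal (z_upper m \<omega>)) ?c * indicator C \<omega> \<partial>P)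
          + (\<integral>\<^sup>+\<omega>. (ennreal (z_upper m \<omega>) - ?c) * indicator C \<omega> \<partial>P)"
        by (intro nn_integral_add) measurable
      also have "\<dots> \<le> (\<integral>\<^sup>+\<omega>. min (ennreal (z_upper m \<omega>)) ?c * indicator C \<omega> \<partial>P) + ?d"
        by (intro add_left_mono z_upper_excess C)
      finally show ?thesis .
    qed
    have "(\<lambda>m. \<integral>\<^sup>+\<omega>. min (ennreal (z_upper m \<omega>)) ?c * indicator C \<omega> \<partial>P)
        \<longlonglongrightarrow> (\<integral>\<^sup>+\<omega>. min (ennreal (z_stopped \<omega>)) ?c * indicator C \<omega> \<partial>P)"
    proof (rule nn_integral_dominated_convergence[where w="\<lambda>\<omega>. ?c"])
      show "AE \<omega> in P. (\<lambda>m. min (ennreal (z_upper m \<omega>)) ?c * indicator C \<omega>) \<longlonglongrightarrow> min (ennreal (z_stopped \<omega>)) ?c * indicator C \<omega>"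
      proof (rule AE_I2)
        fix \<omega> assume "\<omega> \<in> space P"
        then have "(\<lambda>m. min (ennreal (z_upper m \<omega>)) ?c) \<longlonglongrightarrow> min (ennreal (z_stopped \<omega>)) ?c"
          by (intro tendsto_min tendsto_ennrealI z_upper_tendsto tendsto_const)
        then show "(\<lambda>m. min (ennreal (z_upper m \<omega>)) ?c * indicator C \<omega>) \<longlonglongrightarrow> min (ennreal (z_stopped \<omega>)) ?c * indicator C \<omega>"
          by (cases "\<omega> \<in> C") auto
      qed
    qed (auto simp: indicator_def P.emeasure_space_1)
    then have "(\<lambda>m. (\<integral>\<^sup>+\<omega>. min (ennreal (z_upper m \<omega>)) ?c * indicator C \<omega> \<partial>P) + ?d)
        \<longlonglongrightarrow> (\<integral>\<^sup>+\<omega>. min (ennreal (z_stopped \<omega>)) ?c * indicator C \<omega> \<partial>P) + ?d"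
      by (intro tendsto_add tendsto_const)
    then have "emeasure \<mu> C \<le> (\<integral>\<^sup>+\<omega>. min (ennreal (z_stopped \<omega>)) ?c * indicator C \<omega> \<partial>P) + ?d"
      using le by (intro LIMSEQ_le_const) auto
    also have "\<dots> \<le> (\<integral>\<^sup>+\<omega>. ennreal (z_stopped \<omega>) * indicator C \<omega> \<partial>P) + ?d"
      by (intro add_right_mono nn_integral_mono mult_right_mono) auto
    finally show ?thesis .
  qed
  have "(\<lambda>n. (\<integral>\<^sup>+\<omega>. ennreal (z_stopped \<omega>) * indicator C \<omega> \<partial>P) + (\<integral>\<^sup>+\<omega>. ennreal (z \<infinity> \<omega>) - ennreal (real n) \<partial>P))
      \<longlonglongrightarrow> (\<integral>\<^sup>+\<omega>. ennreal (z_stopped \<omega>) * indicator C \<omega> \<partial>P) + 0"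
    by (intro tendsto_add tendsto_const z_infinity_excess_tendsto)
  then show "emeasure \<mu> C \<le> (\<integral>\<^sup>+\<omega>. ennreal (z_stopped \<omega>) * indicator C \<omega> \<partial>P)"
    using bound by (intro LIMSEQ_le_const) auto
qed

lemma z_stopped_integrable: "integrable P z_stopped"
  using z_stopped_nn_integral[OF space_in_pre_sigma]
  by (intro integrable_density z_stopped_nonneg) auto

lemma z_stopped_set_integral:
  "C \<in> sets (pre_sigma T) \<Longrightarrow> (\<integral>\<omega>\<in>C. z_stopped \<omega> \<partial>P) = measure \<mu> C"
  by (intro set_integral_density z_stopped_nonneg z_stopped_nn_integral sets_pre_sigma_P) auto

subsection \<open>The strict past and its discretisation\<close>

lemma strict_past_generator:
  "sets (F 0) \<union> {A \<inter> {\<omega>. t < T \<omega>} | A t. t < \<infinity> \<and> A \<in> sets (F t)} \<subseteq> Pow (space P)"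
  using sets.sets_into_space[of _ "F _"] by (fastforce simp: space_F)

lemma space_strict_past [simp]: "space (strict_past F T) = space P"
  unfolding strict_past_def space_F by (rule space_measure_of[OF strict_past_generator])

lemma sets_strict_past:
  "sets (strict_past F T) = sigma_sets (space P)
     (sets (F 0) \<union> {A \<inter> {\<omega>. t < T \<omega>} | A t. t < \<infinity> \<and> A \<in> sets (F t)})"
  unfolding strict_past_def space_F by (rule sets_measure_of[OF strict_past_generator])

lemma strict_past_0: "A \<in> sets (F 0) \<Longrightarrow> A \<in> sets (strict_past F T)"
  unfolding sets_strict_past by auto

lemma strict_past_greater:
  assumes "A \<in> sets (F t)" "t < \<infinity>"
  shows "A \<inter> {\<omega>. t < T \<omega>} \<in> sets (strict_past F T)"
proof -
  have "A \<inter> {\<omega>. t < T \<omega>} \<in> {A \<inter> {\<omega>. t < T \<omega>} | A t. t < \<infinity> \<and> A \<in> sets (F t)}"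
    using assms by blast
  then show ?thesis
    unfolding sets_strict_past by (intro sigma_sets.Basic UnI2)
qed

lemma pre_sigma_0: "A \<in> sets (F 0) \<Longrightarrow> A \<in> sets (pre_sigma T)"
proof (rule sets_pre_sigmaI[OF stopping])
  fix t assume A: "A \<in> sets (F 0)"
  have "A \<inter> {\<omega>\<in>space (F t). T \<omega> \<le> t} \<in> sets (F t)"
    using A sets_F_mono[of 0 t] stopping_timeD[OF stopping, of t] by (auto simp: pred_def)
  also have "A \<inter> {\<omega>\<in>space (F t). T \<omega> \<le> t} = {\<omega>\<in>A. T \<omega> \<le> t}"
    using sets.sets_into_space[OF A] by (auto simp: space_F)
  finally show "{\<omega>\<in>A. T \<omega> \<le> t} \<in> sets (F t)" .
qed

lemma pre_sigma_greater:
  assumes A: "A \<in> sets (F s)"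
  shows "A \<inter> {\<omega>. s < T \<omega>} \<in> sets (pre_sigma T)"
proof (rule sets_pre_sigmaI[OF stopping])
  fix t
  show "{\<omega> \<in> A \<inter> {\<omega>. s < T \<omega>}. T \<omega> \<le> t} \<in> sets (F t)"
  proof (cases "s \<le> t")
    case True
    have "A \<inter> {\<omega>\<in>space (F s). s < T \<omega>} \<in> sets (F s)"
      using A stopping_timeD2[OF stopping, of s] by (auto simp: pred_def)
    then have "A \<inter> {\<omega>\<in>space (F s). s < T \<omega>} \<in> sets (F t)"
      by (rule subsetD[OF sets_F_mono[OF True]])
    then have "A \<inter> {\<omega>\<in>space (F s). s < T \<omega>} \<inter> {\<omega>\<in>space (F t). T \<omega> \<le> t} \<in> sets (F t)"
      by (rule sets.Int[OF _ predE[OF stopping_timeD[OF stopping]]])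
    also have "A \<inter> {\<omega>\<in>space (F s). s < T \<omega>} \<inter> {\<omega>\<in>space (F t). T \<omega> \<le> t} = {\<omega> \<in> A \<inter> {\<omega>. s < T \<omega>}. T \<omega> \<le> t}"
      using sets.sets_into_space[OF A] by (auto simp: space_F)
    finally show ?thesis .
  next
    case False
    then have "{\<omega> \<in> A \<inter> {\<omega>. s < T \<omega>}. T \<omega> \<le> t} = {}" by auto
    then show ?thesis by (simp only: sets.empty_sets)
  qed
qed

lemma strict_past_subset_pre_sigma: "sets (strict_past F T) \<subseteq> sets (pre_sigma T)"
proof -
  have "sigma_sets (space (pre_sigma T))
     (sets (F 0) \<union> {A \<inter> {\<omega>. t < T \<omega>} | A t. t < \<infinity> \<and> A \<in> sets (F t)}) \<subseteq> sets (pre_sigma T)"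
    by (rule sets.sigma_sets_subset) (auto intro: pre_sigma_0 pre_sigma_greater)
  then show ?thesis
    unfolding sets_strict_past space_pre_sigma .
qed

lemma sets_strict_past_P: "A \<in> sets (strict_past F T) \<Longrightarrow> A \<in> sets P"
  using strict_past_subset_pre_sigma sets_pre_sigma_P by blast

lemma subalgebra_strict_past: "subalgebra P (strict_past F T)"
  using sets_strict_past_P by (auto simp: subalgebra_def)

lemma T_measurable_strict_past [measurable]: "T \<in> borel_measurable (strict_past F T)"
proof (rule borel_measurableI_greater)
  fix t
  show "{\<omega>\<in>space (strict_past F T). t < T \<omega>} \<in> sets (strict_past F T)"
  proof (cases "t < \<infinity>")
    case True
    have "{\<omega>\<in>space (strict_past F T). t < T \<omega>} = space (F t) \<inter> {\<omega>. t < T \<omega>}"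
      by (auto simp: space_F)
    then show ?thesis
      using strict_past_greater[OF sets.top True] by simp
  next
    case False
    then have "t = top" by (simp add: less_top[symmetric])
    then show ?thesis by simp
  qed
qed

text \<open>On \<open>{T = \<infinity>}\<close> an event of \<open>F t\<close> with finite
  \<open>t\<close> coincides with its intersection with \<open>{t < T}\<close>, which is a
  generator; and the events at finite times generate \<open>sets P\<close>.\<close>

lemma strict_past_infinity:
  assumes "A \<in> sets P"
  shows "A \<inter> {\<omega>. T \<omega> = \<infinity>} \<in> sets (strict_past F T)"
proof -
  have S: "{\<omega>\<in>space P. T \<omega> = \<infinity>} \<in> sets (strict_past F T)"
    using measurable_sets[OF T_measurable_strict_past, of "{\<infinity>}"]
    by (auto simp: vimage_def Int_def conj_commute)
  from assms have "A \<in> sigma_sets (space P) (\<Union>t\<in>{..<\<infinity>}. sets (F t))"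
    by (simp only: sets_P_generated)
  then show ?thesis
  proof (induction rule: sigma_sets.induct)
    case (Basic A)
    then obtain t where t: "t < \<infinity>" "A \<in> sets (F t)" by auto
    have "A \<inter> {\<omega>. T \<omega> = \<infinity>} = (A \<inter> {\<omega>. t < T \<omega>}) \<inter> {\<omega>\<in>space P. T \<omega> = \<infinity>}"
      using t sets.sets_into_space[OF t(2)] by (auto simp: space_F)
    then show ?case
      using strict_past_greater[OF t(2,1)] S by auto
  next
    case (Compl A)
    have "(space P - A) \<inter> {\<omega>. T \<omega> = \<infinity>} = {\<omega>\<in>space P. T \<omega> = \<infinity>} - A \<inter> {\<omega>. T \<omega> = \<infinity>}"
      by auto
    then show ?case using S Compl.IH by auto
  next
    case (Union A)
    have "(\<Union>i. A i) \<inter> {\<omega>. T \<omega> = \<infinity>} = (\<Union>i. A i \<inter> {\<omega>. T \<omega> = \<infinity>})"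
      by auto
    then show ?case using sets.countable_nat_UN[of "\<lambda>i. A i \<inter> {\<omega>. T \<omega> = \<infinity>}"] Union.IH by auto
  qed simp
qed

lemma strict_past_zero:
  assumes "A \<in> sets (F 0)"
  shows "A \<inter> {\<omega>. T \<omega> = 0} \<in> sets (strict_past F T)"
proof -
  have "A \<inter> {\<omega>. T \<omega> = 0} = A - A \<inter> {\<omega>. 0 < T \<omega>}"
    by (auto simp: zero_less_iff_neq_zero)
  then show ?thesis
    using strict_past_0[OF assms] strict_past_greater[OF assms] by simp
qed

text \<open>\<open>A\<close> is known at both end points, so intersecting it with the cell gives a
  difference of two generators.\<close>

lemma strict_past_cell:
  assumes A: "A \<in> sets (F (dyadic_left n k))"
  shows "A \<inter> dyadic_cell T n k \<in> sets (strict_past F T)"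
proof -
  have A': "A \<in> sets (F (dyadic_right n k))"
    using A sets_F_mono[OF dyadic_left_le_right[of n k]] by auto
  have "A \<inter> dyadic_cell T n k = A \<inter> {\<omega>. dyadic_left n k < T \<omega>} - A \<inter> {\<omega>. dyadic_right n k < T \<omega>}"
    by (auto simp: dyadic_cell_def)
  then show ?thesis
    using strict_past_greater[OF A] strict_past_greater[OF A'] by simp
qed

lemma cell_F_right:
  assumes A: "A \<in> sets (F (dyadic_left n k))"
  shows "A \<inter> dyadic_cell T n k \<in> sets (F (dyadic_right n k))"
proof -
  have "{\<omega>\<in>A \<inter> dyadic_cell T n k. T \<omega> \<le> dyadic_right n k} \<in> sets (F (dyadic_right n k))"
    using strict_past_cell[OF A] strict_past_subset_pre_sigma by (intro sets_pre_sigmaD[OF stopping]) auto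
  also have "{\<omega>\<in>A \<inter> dyadic_cell T n k. T \<omega> \<le> dyadic_right n k} = A \<inter> dyadic_cell T n k"
    by (auto simp: dyadic_cell_def)
  finally show ?thesis .
qed

lemma space_cell_strict_past: "dyadic_cell T n k \<inter> space P \<in> sets (strict_past F T)"
  using strict_past_cell[OF sets.top, of n k] by (simp add: space_F Int_commute)

text \<open>
  A discretisation of the strict past: on the \<open>k\<close>-th dyadic cell it carries the information of the
  left end point. There is no condition on \<open>{T = \<infinity>}\<close>, where the strict past contains every event.
\<close>

definition dyadic_past_sets :: "nat \<Rightarrow> 'a set set" where
  "dyadic_past_sets n = {B \<in> sets P.
     {\<omega>. T \<omega> = 0} \<inter> B \<in> sets (restrict_space (F 0) {\<omega>. T \<omega> = 0}) \<and>
     (\<forall>k. dyadic_cell T n k \<inter> B \<in> sets (restrict_space (F (dyadic_left n k)) (dyadic_cell T n k)))}"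

definition dyadic_past :: "nat \<Rightarrow> 'a measure" where
  "dyadic_past n = sigma (space P) (dyadic_past_sets n)"

text \<open>Every condition asks that a trace lie in a trace \<sigma>-algebra, and traces respect
  complements and countable unions. Membership in \<open>dyadic_past\<close> can hence be read off
  cell by cell.\<close>

lemma sigma_algebra_dyadic_past: "sigma_algebra (space P) (dyadic_past_sets n)"
  unfolding sigma_algebra_iff2
proof (intro conjI ballI allI impI)
  show "dyadic_past_sets n \<subseteq> Pow (space P)"
    using sets.sets_into_space by (auto simp: dyadic_past_sets_def)
  show "{} \<in> dyadic_past_sets n"
    by (auto simp: dyadic_past_sets_def)
  show "space P - B \<in> dyadic_past_sets n" if "B \<in> dyadic_past_sets n" for B
    using that sets_restrict_Diff[of _ B "F _"] by (auto simp: dyadic_past_sets_def space_F)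
  show "(\<Union>i. B i) \<in> dyadic_past_sets n" if "range B \<subseteq> dyadic_past_sets n" for B :: "nat \<Rightarrow> 'a set"
    using that unfolding dyadic_past_sets_def by (intro CollectI conjI allI sets_restrict_UN) auto
qed

lemma sets_dyadic_past: "sets (dyadic_past n) = dyadic_past_sets n"
  unfolding dyadic_past_def by (rule sigma_algebra.sets_measure_of_eq[OF sigma_algebra_dyadic_past])

lemma space_dyadic_past [simp]: "space (dyadic_past n) = space P"
  unfolding dyadic_past_def by (rule sigma_algebra.space_measure_of_eq[OF sigma_algebra_dyadic_past])

lemma subalgebra_dyadic_past: "subalgebra P (dyadic_past n)"
  by (auto simp: subalgebra_def sets_dyadic_past dyadic_past_sets_def)

lemma dyadic_past_cellD:
  assumes "B \<in> sets (dyadic_past n)"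
  obtains A where "A \<in> sets (F (dyadic_left n k))" "dyadic_cell T n k \<inter> B = dyadic_cell T n k \<inter> A"
proof -
  have "dyadic_cell T n k \<inter> B \<in> sets (restrict_space (F (dyadic_left n k)) (dyadic_cell T n k))"
    using assms by (simp add: sets_dyadic_past dyadic_past_sets_def)
  then show thesis
    using that by (auto simp: sets_restrict_space)
qed

lemma dyadic_past_zeroD:
  assumes "B \<in> sets (dyadic_past n)"
  obtains A where "A \<in> sets (F 0)" "{\<omega>. T \<omega> = 0} \<inter> B = {\<omega>. T \<omega> = 0} \<inter> A"
  using assms by (auto simp: sets_dyadic_past dyadic_past_sets_def sets_restrict_space image_iff)

lemma dyadic_pastI:
  assumes "B \<in> sets P" "C \<in> sets (F 0)" "{\<omega>. T \<omega> = 0} \<inter> B = {\<omega>. T \<omega> = 0} \<inter> C"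
    and "\<And>k. \<exists>A\<in>sets (F (dyadic_left n k)). dyadic_cell T n k \<inter> B = dyadic_cell T n k \<inter> A"
  shows "B \<in> sets (dyadic_past n)"
  using assms by (auto simp: sets_dyadic_past dyadic_past_sets_def sets_restrict_space image_iff)

text \<open>A cell of the finer level lies in one of the coarser level whose left end is no later,
  so the event of \<open>F\<close> that represents \<open>B\<close> there can be kept.\<close>

lemma dyadic_past_Suc: "sets (dyadic_past n) \<subseteq> sets (dyadic_past (Suc n))"
proof
  fix B assume B: "B \<in> sets (dyadic_past n)"
  obtain A0 where A0: "A0 \<in> sets (F 0)" "{\<omega>. T \<omega> = 0} \<inter> B = {\<omega>. T \<omega> = 0} \<inter> A0"
    using dyadic_past_zeroD[OF B] .
  have "B \<in> sets P" using B subalgebra_dyadic_past by (auto simp: subalgebra_def)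
  then show "B \<in> sets (dyadic_past (Suc n))"
  proof (rule dyadic_pastI[OF _ A0])
    fix k
    show "\<exists>A\<in>sets (F (dyadic_left (Suc n) k)). dyadic_cell T (Suc n) k \<inter> B = dyadic_cell T (Suc n) k \<inter> A"
    proof (cases "dyadic_cell T (Suc n) k = {}")
      case False
      then obtain \<omega> where "\<omega> \<in> dyadic_cell T (Suc n) k" by auto
      then have le: "dyadic_left n ((k + 1) div 2) \<le> dyadic_left (Suc n) k"
        by (rule dyadic_cell_Suc)
      obtain A where A: "A \<in> sets (F (dyadic_left n ((k + 1) div 2)))"
          "dyadic_cell T n ((k + 1) div 2) \<inter> B = dyadic_cell T n ((k + 1) div 2) \<inter> A"
        using dyadic_past_cellD[OF B] .
      have "dyadic_cell T (Suc n) k \<subseteq> dyadic_cell T n ((k + 1) div 2)"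
        using dyadic_cell_Suc(1) by (rule subsetI)
      then show ?thesis
        using A sets_F_mono[OF le] by (intro bexI[of _ A]) auto
    qed auto
  qed
qed

lemma dyadic_past_subset: "sets (dyadic_past n) \<subseteq> sets (strict_past F T)"
proof
  fix B assume B: "B \<in> sets (dyadic_past n)"
  have BP: "B \<in> sets P" using B subalgebra_dyadic_past by (auto simp: subalgebra_def)
  have "{\<omega>. T \<omega> = 0} \<inter> B \<in> sets (strict_past F T)"
    using dyadic_past_zeroD[OF B] strict_past_zero by (metis Int_commute)
  moreover have "dyadic_cell T n k \<inter> B \<in> sets (strict_past F T)" for k
    using dyadic_past_cellD[OF B, of k] strict_past_cell by (metis Int_commute)
  moreover have "B \<inter> {\<omega>. T \<omega> = \<infinity>} \<in> sets (strict_past F T)"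
    by (rule strict_past_infinity[OF BP])
  ultimately have "({\<omega>. T \<omega> = 0} \<inter> B) \<union> (\<Union>k. dyadic_cell T n k \<inter> B) \<union> (B \<inter> {\<omega>. T \<omega> = \<infinity>}) \<in> sets (strict_past F T)"
    by (intro sets.Un sets.countable_UN) auto
  also have "({\<omega>. T \<omega> = 0} \<inter> B) \<union> (\<Union>k. dyadic_cell T n k \<inter> B) \<union> (B \<inter> {\<omega>. T \<omega> = \<infinity>}) = B"
  proof -
    have "\<omega> \<in> dyadic_cell T n (dyadic_index T n \<omega>)" if "T \<omega> \<noteq> 0" "T \<omega> \<noteq> \<infinity>" for \<omega>
      using that by (intro dyadic_index_cell) (auto simp: zero_less_iff_neq_zero less_top[symmetric])
    then show ?thesis by blast
  qed
  finally show "B \<in> sets (strict_past F T)" .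
qed

lemma dyadic_past_0:
  assumes A: "A \<in> sets (F 0)"
  shows "A \<in> sets (dyadic_past n)"
proof (rule dyadic_pastI[OF _ A refl])
  show "A \<in> sets P" using A sets_F_subset by auto
  show "\<exists>A'\<in>sets (F (dyadic_left n k)). dyadic_cell T n k \<inter> A = dyadic_cell T n k \<inter> A'" for k
    using A sets_F_mono[of 0 "dyadic_left n k"] by (intro bexI[of _ A]) auto
qed

text \<open>A cell lies either entirely after a dyadic time of its own level or entirely up to it.
  In the first case its left end is no earlier than that time, so \<open>A\<close> is known there;
  in the second the trace is empty.\<close>

lemma dyadic_past_greater:
  assumes A: "A \<in> sets (F (dyadic_right n j))"
  shows "A \<inter> {\<omega>. dyadic_right n j < T \<omega>} \<in> sets (dyadic_past n)"
proof (rule dyadic_pastI[where C="{}"])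
  show "A \<inter> {\<omega>. dyadic_right n j < T \<omega>} \<in> sets P"
    by (intro sets_strict_past_P strict_past_greater A) simp
  show "\<exists>A'\<in>sets (F (dyadic_left n k)).
      dyadic_cell T n k \<inter> (A \<inter> {\<omega>. dyadic_right n j < T \<omega>}) = dyadic_cell T n k \<inter> A'" for k
  proof (cases "j < k")
    case True
    then have le: "dyadic_right n j \<le> dyadic_left n k"
      by (auto simp: dyadic_left_def dyadic_right_def intro!: ennreal_leI divide_right_mono)
    then have "dyadic_cell T n k \<inter> (A \<inter> {\<omega>. dyadic_right n j < T \<omega>}) = dyadic_cell T n k \<inter> A"
      by (auto simp: dyadic_cell_def)
    then show ?thesis
      using A sets_F_mono[OF le] by (intro bexI[of _ A]) auto
  next
    case False
    then have "dyadic_right n k \<le> dyadic_right n j"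
      by (auto simp: dyadic_right_def intro!: ennreal_leI divide_right_mono)
    then have "dyadic_cell T n k \<inter> (A \<inter> {\<omega>. dyadic_right n j < T \<omega>}) = {}"
      by (auto simp: dyadic_cell_def)
    then show ?thesis by (intro bexI[of _ "{}"]) auto
  qed
qed auto

lemma dyadic_past_cell:
  assumes A: "A \<in> sets (F (dyadic_left n k))"
  shows "A \<inter> dyadic_cell T n k \<in> sets (dyadic_past n)"
proof (rule dyadic_pastI[where C="{}"])
  show "A \<inter> dyadic_cell T n k \<in> sets P"
    by (intro sets_strict_past_P strict_past_cell A)
  show "{\<omega>. T \<omega> = 0} \<inter> (A \<inter> dyadic_cell T n k) = {\<omega>. T \<omega> = 0} \<inter> {}"
    using dyadic_cell_bounds[of _ T n k] by fastforce
  show "\<exists>A'\<in>sets (F (dyadic_left n j)).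
      dyadic_cell T n j \<inter> (A \<inter> dyadic_cell T n k) = dyadic_cell T n j \<inter> A'" for j
  proof (cases "j = k")
    case True
    then show ?thesis using A by (intro bexI[of _ A]) auto
  next
    case False
    then have "dyadic_cell T n j \<inter> (A \<inter> dyadic_cell T n k) = {}"
      using dyadic_index_eq[of _ T n] by auto
    then show ?thesis by (intro bexI[of _ "{}"]) auto
  qed
qed simp

text \<open>A generator with arbitrary \<open>t\<close> is the union over \<open>m\<close> of those
  at the times \<open>upper_dyadic m t\<close>. These come after \<open>t\<close>, so that
  \<open>A\<close> is still known, and they tend to \<open>t\<close>, so that nothing of
  \<open>{t < T}\<close> is lost.\<close>

lemma strict_past_eq_dyadic_past:
  "sets (strict_past F T) = sigma_sets (space P) (\<Union>n. sets (dyadic_past n))"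
proof
  interpret S: sigma_algebra "space P" "sigma_sets (space P) (\<Union>n. sets (dyadic_past n))"
    using sets.sets_into_space[of _ "dyadic_past _"] by (intro sigma_algebra_sigma_sets) auto
  show "sets (strict_past F T) \<subseteq> sigma_sets (space P) (\<Union>n. sets (dyadic_past n))"
    unfolding sets_strict_past
  proof (rule S.sigma_sets_subset, rule Un_least)
    show "sets (F 0) \<subseteq> sigma_sets (space P) (\<Union>n. sets (dyadic_past n))"
      using dyadic_past_0 by auto
    show "{A \<inter> {\<omega>. t < T \<omega>} | A t. t < \<infinity> \<and> A \<in> sets (F t)} \<subseteq> sigma_sets (space P) (\<Union>n. sets (dyadic_past n))"
    proof safe
      fix A t assume t: "t < \<infinity>" and A: "A \<in> sets (F t)"
      have "A \<inter> {\<omega>. upper_dyadic m t < T \<omega>} \<in> sets (dyadic_past m)" for m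
      proof -
        obtain j where j: "upper_dyadic m t = dyadic_right m j"
          using t upper_dyadic_eq_infinity[of m t] upper_dyadic_range[of m t] by auto
        have "A \<in> sets (F (dyadic_right m j))"
          using A sets_F_mono[OF less_imp_le[OF upper_dyadic_greater[OF t, of m]]] unfolding j by auto
        then show ?thesis
          unfolding j by (rule dyadic_past_greater)
      qed
      then have "(\<Union>m. A \<inter> {\<omega>. upper_dyadic m t < T \<omega>}) \<in> sigma_sets (space P) (\<Union>n. sets (dyadic_past n))"
        by (intro S.countable_UN) auto
      also have "(\<Union>m. A \<inter> {\<omega>. upper_dyadic m t < T \<omega>}) = A \<inter> {\<omega>. t < T \<omega>}"
      proof -
        have "\<exists>m. upper_dyadic m t < T \<omega>" if "t < T \<omega>" for \<omega>
          using order_tendstoD(2)[OF upper_dyadic_tendsto that] by (auto simp: eventually_sequentially)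
        moreover have "t < T \<omega>" if "upper_dyadic m t < T \<omega>" for m \<omega>
          using upper_dyadic_greater[OF t] that by (rule less_trans)
        ultimately show ?thesis by auto
      qed
      finally show "A \<inter> {\<omega>. t < T \<omega>} \<in> sigma_sets (space P) (\<Union>n. sets (dyadic_past n))" .
    qed
  qed
  have "sigma_sets (space (strict_past F T)) (\<Union>n. sets (dyadic_past n)) \<subseteq> sets (strict_past F T)"
    using dyadic_past_subset by (intro sets.sigma_sets_subset) auto
  then show "sigma_sets (space P) (\<Union>n. sets (dyadic_past n)) \<subseteq> sets (strict_past F T)"
    by simp
qed

section \<open>The quotients as conditional expectations\<close>

lemma cell_pred [measurable]: "Measurable.pred P (\<lambda>\<omega>. \<omega> \<in> dyadic_cell T n k)"
  unfolding dyadic_cell_def by measurable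

text \<open>The part inside the cell of an event known at the left end belongs both to
  \<open>F\<close> at the right end and to the past of \<open>T\<close>. Hence \<open>z\<close> at
  the right end and \<open>z_stopped\<close> integrate over it to the same
  \<open>\<mu>\<close>-measure.\<close>

lemma cell_density_stopped:
  "AE \<omega> in P. cell_density P F z T n k \<omega>
     = real_cond_exp P (F (dyadic_left n k)) (\<lambda>\<omega>. z_stopped \<omega> * indicator (dyadic_cell T n k) \<omega>) \<omega>"
proof -
  let ?S = "dyadic_cell T n k"
  interpret sigma_finite_subalgebra P "F (dyadic_left n k)" by (rule sigma_finite_subalgebra_P_F)
  have int: "integrable P (\<lambda>\<omega>. f \<omega> * indicator ?S \<omega>)" if f: "integrable P f" for f :: "'a \<Rightarrow> real"
  proof (rule Bochner_Integration.integrable_bound[OF f])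
    have [measurable]: "f \<in> borel_measurable P" using f by auto
    show "(\<lambda>\<omega>. f \<omega> * indicator ?S \<omega>) \<in> borel_measurable P"
      by measurable
    show "AE \<omega> in P. norm (f \<omega> * indicator ?S \<omega>) \<le> norm (f \<omega>)"
      by (auto simp: indicator_def)
  qed
  show ?thesis
    unfolding cell_density_def
  proof (rule real_cond_exp_charact)
    fix A assume A: "A \<in> sets (F (dyadic_left n k))"
    have eq: "(\<integral>\<omega>\<in>A. f \<omega> * indicator ?S \<omega> \<partial>P) = (\<integral>\<omega>\<in>A \<inter> ?S. f \<omega> \<partial>P)" for f :: "'a \<Rightarrow> real"
      unfolding set_lebesgue_integral_def by (intro Bochner_Integration.integral_cong) (auto simp: indicator_def)
    have "(\<integral>\<omega>\<in>A. z (dyadic_right n k) \<omega> * indicator ?S \<omega> \<partial>P) = measure \<mu> (A \<inter> ?S)"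
      unfolding eq by (rule z_set_integral[OF cell_F_right[OF A]])
    also have "\<dots> = (\<integral>\<omega>\<in>A. z_stopped \<omega> * indicator ?S \<omega> \<partial>P)"
      unfolding eq using strict_past_cell[OF A] strict_past_subset_pre_sigma
      by (intro z_stopped_set_integral[symmetric]) auto
    also have "\<dots> = (\<integral>\<omega>\<in>A. real_cond_exp P (F (dyadic_left n k)) (\<lambda>\<omega>. z_stopped \<omega> * indicator ?S \<omega>) \<omega> \<partial>P)"
      by (rule real_cond_exp_intA[OF int[OF z_stopped_integrable] A])
    finally show "(\<integral>\<omega>\<in>A. z (dyadic_right n k) \<omega> * indicator ?S \<omega> \<partial>P)
      = (\<integral>\<omega>\<in>A. real_cond_exp P (F (dyadic_left n k)) (\<lambda>\<omega>. z_stopped \<omega> * indicator ?S \<omega>) \<omega> \<partial>P)" .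
  next
    show "integrable P (real_cond_exp P (F (dyadic_left n k)) (\<lambda>\<omega>. z_stopped \<omega> * indicator ?S \<omega>))"
      by (rule real_cond_exp_int[OF int[OF z_stopped_integrable]])
  qed (use int[OF z_integrable] in auto)
qed

text \<open>Inside the cell an event of \<open>dyadic_past n\<close> may be replaced by one known at
  the left end; averaging the indicator of the cell at that time then produces the
  denominator.\<close>

lemma cond_exp_on_cell:
  "AE \<omega> in P. \<omega> \<in> dyadic_cell T n k \<longrightarrow>
     real_cond_exp P (dyadic_past n) z_stopped \<omega> = cell_density P F z T n k \<omega> / cell_prob P F T n k \<omega>"
proof -
  let ?S = "dyadic_cell T n k" and ?L = "F (dyadic_left n k)" and ?G = "dyadic_past n"
  let ?W = "\<lambda>\<omega>. z_stopped \<omega> * indicator ?S \<omega>"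
  let ?d = "cell_density P F z T n k" and ?p = "cell_prob P F T n k"
  interpret L: sigma_finite_subalgebra P ?L by (rule sigma_finite_subalgebra_P_F)
  interpret G: sigma_finite_subalgebra P ?G
    using subalgebra_dyadic_past by (rule P.sigma_finite_subalgebraI)
  have d[measurable]: "?d \<in> borel_measurable ?L" and p[measurable]: "?p \<in> borel_measurable ?L"
    unfolding cell_density_def cell_prob_def by auto
  have SG: "?S \<inter> space ?G \<in> sets ?G"
    using dyadic_past_cell[OF sets.top, of n k] by (simp add: space_F Int_commute)
  have intW: "integrable P ?W"
    by (rule Bochner_Integration.integrable_bound[OF z_stopped_integrable]) (measurable, auto simp: indicator_def)
  have posW: "AE \<omega> in P. 0 \<le> ?W \<omega>"
    using z_stopped_nonneg by eventually_elim (simp add: indicator_def)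
  have int1: "integrable P (indicator ?S :: 'a \<Rightarrow> real)"
    by (rule P.integrable_const_bound[of _ 1]) (auto simp: indicator_def intro!: borel_measurable_indicator')
  have pos1: "AE \<omega> in P. 0 \<le> (indicator ?S \<omega> :: real)"
    by simp
  have posd: "AE \<omega> in P. 0 \<le> ?d \<omega>"
    using cell_density_stopped[of n k] L.real_cond_exp_pos[OF posW] intW by auto
  have posp: "AE \<omega> in P. 0 \<le> ?p \<omega>"
    unfolding cell_prob_def using int1 by (intro L.real_cond_exp_pos pos1) auto
  have intgd: "(\<integral>\<^sup>+\<omega>. g \<omega> * ennreal (?d \<omega>) \<partial>P) = (\<integral>\<^sup>+\<omega>. g \<omega> * ennreal (?W \<omega>) \<partial>P)"
    if "g \<in> borel_measurable ?L" for g
  proof -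
    have "(\<integral>\<^sup>+\<omega>. g \<omega> * ennreal (?d \<omega>) \<partial>P) = (\<integral>\<^sup>+\<omega>. g \<omega> * ennreal (real_cond_exp P ?L ?W \<omega>) \<partial>P)"
      using cell_density_stopped[of n k] by (intro nn_integral_cong_AE) auto
    then show ?thesis
      using L.real_cond_exp_nn_intg[OF intW posW that] by simp
  qed
  have intgp: "(\<integral>\<^sup>+\<omega>. g \<omega> * ennreal (?p \<omega>) \<partial>P) = (\<integral>\<^sup>+\<omega>. g \<omega> * ennreal (indicator ?S \<omega>) \<partial>P)"
    if "g \<in> borel_measurable ?L" for g
    unfolding cell_prob_def by (rule L.real_cond_exp_nn_intg[OF int1 pos1 that])
  \<comment> \<open>Division by 0 yields 0, so recovering \<open>?d\<close> from
    \<open>?d / ?p * ?p\<close> requires the numerator to vanish with the denominator. It does,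
    since the cell has no mass there.\<close>
  have zero: "AE \<omega> in P. ?p \<omega> = 0 \<longrightarrow> ?d \<omega> = 0"
  proof -
    define Z where "Z = {\<omega>\<in>space ?L. ?p \<omega> = 0}"
    have Z[measurable]: "Z \<in> sets ?L" unfolding Z_def by measurable
    have ZP[measurable]: "Z \<in> sets P" using Z sets_F_subset by (rule rev_subsetD)
    have [measurable]: "?d \<in> borel_measurable P"
      using measurable_from_subalg[OF subalgebra_P_F d] .
    have "(\<integral>\<^sup>+\<omega>. indicator Z \<omega> * ennreal (indicator ?S \<omega>) \<partial>P) = (\<integral>\<^sup>+\<omega>. indicator Z \<omega> * ennreal (?p \<omega>) \<partial>P)"
      by (rule intgp[symmetric]) measurable
    also have "\<dots> = (\<integral>\<^sup>+\<omega>. 0 \<partial>P)"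
      by (intro nn_integral_cong) (auto simp: Z_def indicator_def)
    finally have "AE \<omega> in P. indicator Z \<omega> * ennreal (indicator ?S \<omega>) = 0"
      by (simp add: nn_integral_0_iff_AE)
    then have "(\<integral>\<^sup>+\<omega>. indicator Z \<omega> * ennreal (?W \<omega>) \<partial>P) = (\<integral>\<^sup>+\<omega>. 0 \<partial>P)"
      by (intro nn_integral_cong_AE) (auto simp: indicator_def)
    then have "(\<integral>\<^sup>+\<omega>. indicator Z \<omega> * ennreal (?d \<omega>) \<partial>P) = 0"
      by (subst intgd) auto
    then have "AE \<omega> in P. indicator Z \<omega> * ennreal (?d \<omega>) = 0"
      by (simp add: nn_integral_0_iff_AE)
    then show ?thesis
      using posd AE_space by eventually_elim (auto simp: Z_def indicator_def space_F ennreal_eq_0_iff)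
  qed
  define h where "h \<omega> = (if \<omega> \<in> ?S then ?d \<omega> / ?p \<omega> else 0)" for \<omega>
  have h[measurable]: "h \<in> borel_measurable ?G"
    unfolding h_def
    by (rule borel_measurable_If_subset[where L="?L", OF _ _ SG dyadic_past_cell]) (auto simp: space_F)
  have "AE \<omega> in P. ennreal (h \<omega>) = nn_cond_exp P ?G (\<lambda>\<omega>. ennreal (?W \<omega>)) \<omega>"
  proof (rule G.nn_cond_exp_charact)
    fix B assume B: "B \<in> sets ?G"
    obtain A where A[measurable]: "A \<in> sets ?L" and BA: "?S \<inter> B = ?S \<inter> A"
      using dyadic_past_cellD[OF B] .
    have ind: "\<omega> \<in> ?S \<Longrightarrow> \<omega> \<in> B \<longleftrightarrow> \<omega> \<in> A" for \<omega> using BA by auto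
    have "(\<integral>\<^sup>+\<omega>\<in>B. ennreal (h \<omega>) \<partial>P) = (\<integral>\<^sup>+\<omega>. (indicator A \<omega> * ennreal (?d \<omega> / ?p \<omega>)) * ennreal (indicator ?S \<omega>) \<partial>P)"
      by (intro nn_integral_cong) (auto simp: h_def indicator_def ind)
    \<comment> \<open>The factor in parentheses is measurable at the left end, so the indicator of
      the cell may be exchanged for its conditional probability.\<close>
    also have "\<dots> = (\<integral>\<^sup>+\<omega>. (indicator A \<omega> * ennreal (?d \<omega> / ?p \<omega>)) * ennreal (?p \<omega>) \<partial>P)"
      by (rule intgp[symmetric]) measurable
    also have "\<dots> = (\<integral>\<^sup>+\<omega>. indicator A \<omega> * ennreal (?d \<omega>) \<partial>P)"
    proof (rule nn_integral_cong_AE)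
      show "AE \<omega> in P. indicator A \<omega> * ennreal (?d \<omega> / ?p \<omega>) * ennreal (?p \<omega>) = indicator A \<omega> * ennreal (?d \<omega>)"
        using zero posd posp
      proof eventually_elim
        case (elim \<omega>)
        then have "ennreal (?d \<omega> / ?p \<omega>) * ennreal (?p \<omega>) = ennreal (?d \<omega>)"
          by (cases "?p \<omega> = 0") (auto simp: ennreal_mult''[symmetric])
        then show ?case by (simp add: mult.assoc)
      qed
    qed
    also have "\<dots> = (\<integral>\<^sup>+\<omega>. indicator A \<omega> * ennreal (?W \<omega>) \<partial>P)"
      by (rule intgd) measurable
    also have "\<dots> = (\<integral>\<^sup>+\<omega>\<in>B. ennreal (?W \<omega>) \<partial>P)"
      by (intro nn_integral_cong) (auto simp: indicator_def ind)
    finally show "(\<integral>\<^sup>+\<omega>\<in>B. ennreal (?W \<omega>) \<partial>P) = (\<integral>\<^sup>+\<omega>\<in>B. ennreal (h \<omega>) \<partial>P)" ..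
  qed measurable
  moreover have "AE \<omega> in P. ennreal (real_cond_exp P ?G ?W \<omega>) = nn_cond_exp P ?G (\<lambda>\<omega>. ennreal (?W \<omega>)) \<omega>"
    by (rule G.nn_cond_exp_eq_real_cond_exp[OF intW posW])
  moreover have "AE \<omega> in P. 0 \<le> real_cond_exp P ?G ?W \<omega>"
    using posW intW by (intro G.real_cond_exp_pos) auto
  moreover have "AE \<omega> in P. real_cond_exp P ?G (\<lambda>\<omega>. indicator ?S \<omega> * z_stopped \<omega>) \<omega> = indicator ?S \<omega> * real_cond_exp P ?G z_stopped \<omega>"
    using SG intW by (intro G.real_cond_exp_mult) (auto simp: mult.commute borel_measurable_indicator_iff)
  ultimately show ?thesis
    using posd posp
  proof eventually_elim
    case (elim \<omega>)
    show ?case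
    proof
      assume S: "\<omega> \<in> ?S"
      then have "ennreal (real_cond_exp P ?G ?W \<omega>) = ennreal (?d \<omega> / ?p \<omega>)"
        using elim by (simp add: h_def)
      then have "real_cond_exp P ?G ?W \<omega> = ?d \<omega> / ?p \<omega>"
        using elim by (subst (asm) ennreal_inj) auto
      then show "real_cond_exp P ?G z_stopped \<omega> = ?d \<omega> / ?p \<omega>"
        using elim S by (simp add: mult.commute)
    qed
  qed
qed

subsection \<open>The limits\<close>

lemma sigma_finite_strict_past: "sigma_finite_subalgebra P (strict_past F T)"
  using subalgebra_strict_past by (rule P.sigma_finite_subalgebraI)

abbreviation z_predicted :: "'a \<Rightarrow> real" where
  "z_predicted \<equiv> real_cond_exp P (strict_past F T) z_stopped"

lemma z_predicted_nonneg: "AE \<omega> in P. 0 \<le> z_predicted \<omega>"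
proof -
  interpret sigma_finite_subalgebra P "strict_past F T" by (rule sigma_finite_strict_past)
  show ?thesis
    by (rule real_cond_exp_pos[OF z_stopped_nonneg]) measurable
qed

text \<open>Levy's theorem wants a limit measurable for the strict past, so it is applied to
  \<open>z_predicted\<close>. By the tower property this has the same conditional expectations given
  \<open>dyadic_past n\<close> as \<open>z_stopped\<close>.\<close>

lemma dyadic_past_cond_exp_tendsto:
  "AE \<omega> in P. (\<lambda>n. real_cond_exp P (dyadic_past n) z_stopped \<omega>) \<longlonglongrightarrow> z_predicted \<omega>"
proof -
  interpret S: sigma_finite_subalgebra P "strict_past F T" by (rule sigma_finite_strict_past)
  interpret D: filtered_prob_space P dyadic_past UNIV
  proof unfold_locales
    show "sets (dyadic_past m) \<subseteq> sets (dyadic_past n)" if "m \<le> n" for m n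
      using lift_Suc_mono_le[of "\<lambda>n. sets (dyadic_past n)", OF dyadic_past_Suc that] .
  qed (auto intro: subalgebra_dyadic_past)
  have sets_eq: "sets D.F_limit = sets (strict_past F T)"
    unfolding D.sets_F_limit strict_past_eq_dyadic_past by simp
  have "AE \<omega> in P. \<forall>e>0. \<exists>m\<in>UNIV. \<forall>n\<in>UNIV. m \<le> n \<longrightarrow>
      \<bar>real_cond_exp P (dyadic_past n) z_stopped \<omega> - z_predicted \<omega>\<bar> \<le> e"
  proof (rule D.Levy_upward)
    show "integrable P z_predicted"
      by (rule S.real_cond_exp_int[OF z_stopped_integrable])
    show "z_predicted \<in> borel_measurable D.F_limit"
      using borel_measurable_cond_exp[of P "strict_past F T" z_stopped]
      by (simp cong: measurable_cong_sets[OF sets_eq refl])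
    show "real_cond_exp P (dyadic_past n) z_stopped \<in> borel_measurable (dyadic_past n)" for n
      by (rule borel_measurable_cond_exp)
    show "AE \<omega> in P. real_cond_exp P (dyadic_past n) z_stopped \<omega> = real_cond_exp P (dyadic_past n) z_predicted \<omega>" for n
    proof -
      interpret G: sigma_finite_subalgebra P "dyadic_past n"
        using subalgebra_dyadic_past by (rule P.sigma_finite_subalgebraI)
      have "subalgebra (strict_past F T) (dyadic_past n)"
        using dyadic_past_subset by (simp add: subalgebra_def)
      from G.real_cond_exp_nested_subalg[OF subalgebra_strict_past this z_stopped_integrable]
      show ?thesis by eventually_elim simp
    qed
  qed
  then show ?thesis
  proof eventually_elim
    case (elim \<omega>)
    show ?case
    proof (rule LIMSEQ_I)
      fix e :: real assume "0 < e"
      then obtain m where m: "\<And>n. m \<le> n \<Longrightarrow> \<bar>real_cond_exp P (dyadic_past n) z_stopped \<omega> - z_predicted \<omega>\<bar> \<le> e / 2"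
        using elim by (metis UNIV_I half_gt_zero)
      have "norm (real_cond_exp P (dyadic_past n) z_stopped \<omega> - z_predicted \<omega>) < e" if "m \<le> n" for n
        using m[OF that] \<open>0 < e\<close> by simp
      then show "\<exists>m. \<forall>n\<ge>m. norm (real_cond_exp P (dyadic_past n) z_stopped \<omega> - z_predicted \<omega>) < e"
        by blast
    qed
  qed
qed

lemma approx_E_tendsto:
  "AE \<omega> in P. 0 < T \<omega> \<and> T \<omega> < \<infinity> \<longrightarrow> (\<lambda>n. approx_E P F z T n \<omega>) \<longlonglongrightarrow> z_predicted \<omega>"
proof -
  \<comment> \<open>The index depends on \<open>\<omega>\<close>, so one null set has to serve all
    \<open>n\<close> and \<open>k\<close>.\<close>
  have "AE \<omega> in P. \<forall>n k. \<omega> \<in> dyadic_cell T n k \<longrightarrow>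
     real_cond_exp P (dyadic_past n) z_stopped \<omega> = cell_density P F z T n k \<omega> / cell_prob P F T n k \<omega>"
    unfolding AE_all_countable by (intro allI cond_exp_on_cell)
  with dyadic_past_cond_exp_tendsto show ?thesis
  proof eventually_elim
    case (elim \<omega>)
    show ?case
    proof
      assume "0 < T \<omega> \<and> T \<omega> < \<infinity>"
      then have "\<omega> \<in> dyadic_cell T n (dyadic_index T n \<omega>)" for n
        using dyadic_index_cell[of T \<omega> n] by simp
      then have "approx_E P F z T n \<omega> = real_cond_exp P (dyadic_past n) z_stopped \<omega>" for n
        using elim(2) unfolding approx_E_def Let_def by metis
      then show "(\<lambda>n. approx_E P F z T n \<omega>) \<longlonglongrightarrow> z_predicted \<omega>"
        using elim(1) by simp
    qed
  qed
qed

text \<open>On these two events the stopped value is \<open>z 0\<close> or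
  \<open>z \<infinity>\<close>, and the strict past contains the traces of \<open>F 0\<close> and of
  \<open>P\<close> there. The restriction of \<open>z_stopped\<close> is thus already measurable for
  it.\<close>

lemma z_predicted_boundary:
  "AE \<omega> in P. T \<omega> = 0 \<or> T \<omega> = \<infinity> \<longrightarrow> z_predicted \<omega> = z_stopped \<omega>"
proof -
  interpret S: sigma_finite_subalgebra P "strict_past F T" by (rule sigma_finite_strict_past)
  define B where "B = {\<omega>. T \<omega> = 0 \<or> T \<omega> = \<infinity>}"
  have [measurable]: "Measurable.pred (strict_past F T) (\<lambda>\<omega>. \<omega> \<in> B)" "Measurable.pred P (\<lambda>\<omega>. \<omega> \<in> B)"
    unfolding B_def by measurable
  have eq: "indicator B \<omega> * z_stopped \<omega>
      = (if \<omega> \<in> {\<omega>. T \<omega> = 0} then z 0 \<omega> else 0) + (if \<omega> \<in> {\<omega>. T \<omega> = \<infinity>} then z \<infinity> \<omega> else 0)" for \<omega>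
    by (auto simp: B_def z_stopped_def indicator_def)
  have "(\<lambda>\<omega>. if \<omega> \<in> {\<omega>. T \<omega> = 0} then z 0 \<omega> else 0) \<in> borel_measurable (strict_past F T)"
  proof (rule borel_measurable_If_subset[where L="F 0"])
    show "{\<omega>. T \<omega> = 0} \<inter> space (strict_past F T) \<in> sets (strict_past F T)"
      using strict_past_zero[OF sets.top] by (simp add: space_F Int_commute)
  qed (auto simp: space_F strict_past_zero)
  moreover have "(\<lambda>\<omega>. if \<omega> \<in> {\<omega>. T \<omega> = \<infinity>} then z \<infinity> \<omega> else 0) \<in> borel_measurable (strict_past F T)"
  proof (rule borel_measurable_If_subset[where L=P])
    show "{\<omega>. T \<omega> = \<infinity>} \<inter> space (strict_past F T) \<in> sets (strict_past F T)"
      using strict_past_infinity[OF sets.top] by (simp add: Int_commute)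
    show "A \<inter> {\<omega>. T \<omega> = \<infinity>} \<in> sets (strict_past F T)" if "A \<in> sets P" for A
      by (rule strict_past_infinity[OF that])
  qed auto
  ultimately have m: "(\<lambda>\<omega>. indicator B \<omega> * z_stopped \<omega>) \<in> borel_measurable (strict_past F T)"
    unfolding eq by (rule borel_measurable_add)
  have int: "integrable P (\<lambda>\<omega>. indicator B \<omega> * z_stopped \<omega>)"
    by (rule Bochner_Integration.integrable_bound[OF z_stopped_integrable]) (measurable, auto simp: indicator_def)
  have "AE \<omega> in P. real_cond_exp P (strict_past F T) (\<lambda>\<omega>. indicator B \<omega> * z_stopped \<omega>) \<omega> = indicator B \<omega> * z_predicted \<omega>"
    by (rule S.real_cond_exp_mult[OF _ _ int]) measurable
  moreover have "AE \<omega> in P. real_cond_exp P (strict_past F T) (\<lambda>\<omega>. indicator B \<omega> * z_stopped \<omega>) \<omega> = indicator B \<omega> * z_stopped \<omega>"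
    by (rule S.real_cond_exp_F_meas[OF int m])
  ultimately show ?thesis
    by eventually_elim (auto simp: B_def)
qed

text \<open>\<open>density_process\<close> demands left limits at finite times only. At
  \<open>\<infinity>\<close> Levy's theorem along the rational times applies to the given values of
  \<open>z\<close>, and right-continuity extends the limit to all times.\<close>

lemma z_left_limit_infinity: "AE \<omega> in P. left_limit (\<lambda>t. z t \<omega>) \<infinity> = z \<infinity> \<omega>"
proof -
  interpret R: filtered_prob_space P F rational_times
  proof unfold_locales
    show "rational_times \<noteq> {}"
      by (simp add: rational_times_def)
    show "subalgebra P (F t)" for t
      by (rule subalgebra_P_F)
    show "sets (F s) \<subseteq> sets (F t)" if "s \<le> t" for s t
      by (rule sets_F_mono[OF that])
    show "countable rational_times"
      by (rule countable_rational_times)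
  qed
  have "sets P \<subseteq> sets R.F_limit"
    unfolding sets_P_generated R.sets_F_limit
  proof (rule sigma_sets_mono', rule UN_least)
    fix t :: ennreal assume "t \<in> {..<\<infinity>}"
    then obtain q where "q \<in> rational_times" "t < q"
      using rational_times_dense[of t \<infinity>] by auto
    then show "sets (F t) \<subseteq> (\<Union>t\<in>rational_times. sets (F t))"
      using sets_F_mono[of t q] by fastforce
  qed
  then have "subalgebra R.F_limit P"
    by (simp add: subalgebra_def R.space_F_limit)
  then have "z \<infinity> \<in> borel_measurable R.F_limit"
    by (rule measurable_from_subalg) (rule z_measurable)
  then have "AE \<omega> in P. \<forall>e>0. \<exists>s\<in>rational_times. \<forall>t\<in>rational_times. s \<le> t \<longrightarrow> \<bar>z t \<omega> - z \<infinity> \<omega>\<bar> \<le> e"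
    by (intro R.Levy_upward z_eq_cond_exp z_integrable z_measurable_F)
  then show ?thesis
    using AE_space
  proof eventually_elim
    case (elim \<omega>)
    have "((\<lambda>t. z t \<omega>) \<longlongrightarrow> z \<infinity> \<omega>) (at_left \<infinity>)"
    proof (rule at_left_tendsto_rational)
      show "continuous (at_right u) (\<lambda>t. z t \<omega>)" if "u < \<infinity>" for u
        using z_right_continuous elim that by blast
      show "\<exists>s<\<infinity>. \<forall>q\<in>rational_times. s \<le> q \<longrightarrow> q < \<infinity> \<longrightarrow> \<bar>z q \<omega> - z \<infinity> \<omega>\<bar> \<le> e" if "0 < e" for e
        using elim that rational_times_finite by blast
    qed simp
    then show ?case
      by (rule left_limit_eqI) simp
  qed
qed

text \<open>On an event of \<open>F q\<close> where \<open>z q\<close> is below a bound,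
  \<open>\<mu>\<close> is at most this bound times \<open>P\<close>. First passage extends the
  comparison to the union over all rational \<open>q\<close>, whose \<open>P\<close>-measure is at
  most 1.\<close>

lemma mu_inf_z_zero:
  "{\<omega>\<in>space P. \<forall>n. \<exists>q\<in>rational_times. z q \<omega> < 1 / real (Suc n)} \<in> null_sets \<mu>" (is "?N \<in> _")
proof -
  define D where "D n q = {\<omega>\<in>space P. z q \<omega> < 1 / real (Suc n)}" for n :: nat and q
  have D: "D n q \<in> sets (F q)" for n q
  proof -
    have "{\<omega>\<in>space (F q). z q \<omega> < 1 / real (Suc n)} \<in> sets (F q)" by measurable
    then show ?thesis by (simp add: D_def space_F)
  qed
  have DP: "D n q \<in> sets P" for n q
    using D sets_F_subset by (rule rev_subsetD)
  have U: "(\<Union>q\<in>rational_times. D n q) \<in> sets P" for n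
    using DP by (intro sets.countable_UN' countable_rational_times) auto
  have N_eq: "?N = (\<Inter>n. \<Union>q\<in>rational_times. D n q)"
    by (auto simp: D_def)
  have N: "?N \<in> sets P"
    unfolding N_eq using U by (intro sets.countable_INT) auto
  have bound: "emeasure \<mu> ?N \<le> ennreal (1 / real (Suc n))" for n
  proof -
    let ?e = "1 / real (Suc n)"
    have "emeasure \<mu> ?N \<le> emeasure \<mu> (\<Union>q\<in>rational_times. D n q)"
      unfolding N_eq using U by (intro emeasure_mono) (auto simp: sets_mu)
    also have "\<dots> \<le> emeasure (scale_measure (ennreal ?e) P) (\<Union>q\<in>rational_times. D n q)"
    proof (rule emeasure_first_passage[where F=F])
      fix t A assume A: "A \<in> sets (F t)" "A \<subseteq> D n t"
      have AP[measurable]: "A \<in> sets P" using A(1) sets_F_subset by (rule rev_subsetD)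
      have "emeasure \<mu> A = (\<integral>\<^sup>+\<omega>. ennreal (z t \<omega>) * indicator A \<omega> \<partial>P)"
        by (rule z_nn_integral[OF A(1), symmetric])
      also have "\<dots> \<le> (\<integral>\<^sup>+\<omega>. ennreal ?e * indicator A \<omega> \<partial>P)"
        using A(2) by (intro nn_integral_mono) (auto simp: indicator_def D_def intro!: ennreal_leI less_imp_le)
      also have "\<dots> = emeasure (scale_measure (ennreal ?e) P) A"
        by (simp add: nn_integral_cmult_indicator)
      finally show "emeasure \<mu> A \<le> emeasure (scale_measure (ennreal ?e) P) A" .
    next
      show "sets (F t) \<subseteq> sets \<mu>" for t
        using sets_F_subset by (simp add: sets_mu)
    qed (simp_all add: countable_rational_times sets_mu D sets_F_mono)
    also have "\<dots> = ennreal ?e * emeasure P (\<Union>q\<in>rational_times. D n q)"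
      by simp
    also have "\<dots> \<le> ennreal ?e * 1"
      by (intro mult_left_mono P.emeasure_le_1) simp
    finally show ?thesis by simp
  qed
  have "(\<lambda>n. ennreal (1 / real (Suc n))) \<longlonglongrightarrow> ennreal 0"
    by (intro tendsto_ennrealI LIMSEQ_Suc[OF lim_1_over_n])
  then have "emeasure \<mu> ?N \<le> ennreal 0"
    using bound by (intro LIMSEQ_le_const) auto
  then show ?thesis
    using N by (auto simp: null_sets_def sets_mu)
qed

section \<open>Measurability with respect to the strict past\<close>

definition has_left_limit :: "'a \<Rightarrow> bool" where
  "has_left_limit \<omega> \<longleftrightarrow> 0 < T \<omega> \<and> T \<omega> < \<infinity> \<and> (\<exists>l. ((\<lambda>t. z t \<omega>) \<longlongrightarrow> l) (at_left (T \<omega>)))"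

text \<open>The implication fails on the intersection of \<open>{t < T}\<close> with an event of
  \<open>F t\<close>, that is, on a generator.\<close>

lemma strict_past_pred_before:
  assumes A: "Measurable.pred (F t) Q"
  shows "Measurable.pred (strict_past F T) (\<lambda>\<omega>. t < T \<omega> \<longrightarrow> Q \<omega>)"
proof (cases "t < \<infinity>")
  case True
  have "space (F t) - {\<omega>\<in>space (F t). Q \<omega>} \<in> sets (F t)"
    by (intro sets.Diff sets.top predE[OF A])
  also have "space (F t) - {\<omega>\<in>space (F t). Q \<omega>} = {\<omega>\<in>space (F t). \<not> Q \<omega>}"
    by auto
  finally have "{\<omega>\<in>space (F t). \<not> Q \<omega>} \<in> sets (F t)" .
  from strict_past_greater[OF this True]
  have "space (strict_past F T) - {\<omega>\<in>space (F t). \<not> Q \<omega>} \<inter> {\<omega>. t < T \<omega>} \<in> sets (strict_past F T)"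
    by (rule sets.compl_sets)
  also have "space (strict_past F T) - {\<omega>\<in>space (F t). \<not> Q \<omega>} \<inter> {\<omega>. t < T \<omega>}
      = {\<omega>\<in>space (strict_past F T). t < T \<omega> \<longrightarrow> Q \<omega>}"
    by (auto simp: space_F)
  finally show ?thesis by (simp add: pred_def)
next
  case False
  then have "t = top" by (simp add: less_top[symmetric])
  then show ?thesis by simp
qed

lemma z_measurable_later:
  assumes "s \<le> t"
  shows "z s \<in> borel_measurable (F t)"
proof -
  have "subalgebra (F t) (F s)"
    using sets_F_mono[OF assms] by (simp add: subalgebra_def space_F)
  then show ?thesis
    by (rule measurable_from_subalg) (rule z_measurable_F)
qed

text \<open>In the rational criterion \<open>z r\<close> and \<open>z r'\<close> are compared only
  if both times lie before \<open>T\<close>, that is, if their maximum does; each comparison is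
  therefore a condition of the strict past.\<close>

lemma has_left_limit_measurable [measurable]: "Measurable.pred (strict_past F T) has_left_limit"
proof -
  define C where "C q r r' n \<omega> \<longleftrightarrow> (q < r \<longrightarrow> r < T \<omega> \<longrightarrow> q < r' \<longrightarrow> r' < T \<omega> \<longrightarrow> \<bar>z r \<omega> - z r' \<omega>\<bar> \<le> 1 / real (Suc n))"
    for q r r' and n :: nat and \<omega>
  have C: "Measurable.pred (strict_past F T) (C q r r' n)" for q r r' n
  proof (cases "q < r \<and> q < r'")
    case True
    have [measurable]: "z r \<in> borel_measurable (F (max r r'))" "z r' \<in> borel_measurable (F (max r r'))"
      by (rule z_measurable_later[OF max.cobounded1], rule z_measurable_later[OF max.cobounded2])
    have "Measurable.pred (strict_past F T) (\<lambda>\<omega>. max r r' < T \<omega> \<longrightarrow> \<bar>z r \<omega> - z r' \<omega>\<bar> \<le> 1 / real (Suc n))"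
      by (rule strict_past_pred_before) measurable
    moreover have "C q r r' n = (\<lambda>\<omega>. max r r' < T \<omega> \<longrightarrow> \<bar>z r \<omega> - z r' \<omega>\<bar> \<le> 1 / real (Suc n))"
      using True by (auto simp: C_def fun_eq_iff)
    ultimately show ?thesis by (simp only:)
  next
    case False
    then have "C q r r' n = (\<lambda>\<omega>. True)" by (auto simp: C_def fun_eq_iff)
    then show ?thesis by simp
  qed
  have "Measurable.pred (strict_past F T) (\<lambda>\<omega>. (0 < T \<omega> \<and> T \<omega> < \<infinity>) \<and> (\<forall>n. \<exists>q\<in>rational_times. q < T \<omega> \<and>
      (\<forall>r\<in>rational_times. \<forall>r'\<in>rational_times. C q r r' n \<omega>)))"
  proof (intro pred_intros_logic(3) pred_intros_countable(1) measurable_pred_countable countable_rational_times C)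
    show "Measurable.pred (strict_past F T) (\<lambda>\<omega>. 0 < T \<omega>)" "Measurable.pred (strict_past F T) (\<lambda>\<omega>. T \<omega> < \<infinity>)"
      "Measurable.pred (strict_past F T) (\<lambda>\<omega>. q < T \<omega>)" for q
      by measurable
  qed
  also have "?this \<longleftrightarrow> ?thesis"
  proof (rule measurable_cong)
    fix \<omega> assume \<omega>: "\<omega> \<in> space (strict_past F T)"
    show "((0 < T \<omega> \<and> T \<omega> < \<infinity>) \<and> (\<forall>n. \<exists>q\<in>rational_times. q < T \<omega> \<and>
      (\<forall>r\<in>rational_times. \<forall>r'\<in>rational_times. C q r r' n \<omega>))) = has_left_limit \<omega>"
    proof (cases "0 < T \<omega> \<and> T \<omega> < \<infinity>")
      case True
      have "continuous (at_right u) (\<lambda>t. z t \<omega>)" if "u < T \<omega>" for u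
        using z_right_continuous[of \<omega> u] \<omega> less_trans[OF that, of \<infinity>] True by simp
      from left_limit_exists_iff[OF this, of "T \<omega>"] show ?thesis
        using True by (simp add: has_left_limit_def C_def)
    qed (auto simp: has_left_limit_def)
  qed
  finally show ?thesis .
qed

text \<open>The index is constant on each cell, and there the strict past contains the trace of
  \<open>F\<close> at the left end.\<close>

lemma cellwise_measurable:
  assumes h: "\<And>k. h k \<in> borel_measurable (F (dyadic_left n k))"
  shows "(\<lambda>\<omega>. if 0 < T \<omega> \<and> T \<omega> < \<infinity> then h (dyadic_index T n \<omega>) \<omega> else (0::real)) \<in> borel_measurable (strict_past F T)"
proof -
  define f where "f k \<omega> = (if \<omega> \<in> dyadic_cell T n k then h k \<omega> else 0)" for k \<omega>
  \<comment> \<open>Index 0 can serve as default: cell 0 is empty, so \<open>f 0\<close>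
    vanishes.\<close>
  define g where "g \<omega> = (if 0 < T \<omega> \<and> T \<omega> < \<infinity> then dyadic_index T n \<omega> else 0)" for \<omega>
  have f: "f k \<in> borel_measurable (strict_past F T)" for k
    unfolding f_def
    using space_cell_strict_past[of n k]
    by (intro borel_measurable_If_subset[where L="F (dyadic_left n k)"] h strict_past_cell) (auto simp: space_F)
  have g: "g \<in> strict_past F T \<rightarrow>\<^sub>M count_space UNIV"
    unfolding measurable_count_space_eq2_countable
  proof (intro conjI ballI)
    fix k
    have "{\<omega>\<in>space (strict_past F T). \<not> (0 < T \<omega> \<and> T \<omega> < \<infinity>)} \<in> sets (strict_past F T)"
      by measurable
    then have "dyadic_cell T n k \<inter> space P \<union> (if k = 0 then {\<omega>\<in>space (strict_past F T). \<not> (0 < T \<omega> \<and> T \<omega> < \<infinity>)} else {}) \<in> sets (strict_past F T)"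
      using space_cell_strict_past by (intro sets.Un) auto
    also have "dyadic_cell T n k \<inter> space P \<union> (if k = 0 then {\<omega>\<in>space (strict_past F T). \<not> (0 < T \<omega> \<and> T \<omega> < \<infinity>)} else {})
        = g -` {k} \<inter> space (strict_past F T)"
    proof (rule set_eqI)
      fix \<omega>
      show "\<omega> \<in> dyadic_cell T n k \<inter> space P \<union> (if k = 0 then {\<omega>\<in>space (strict_past F T). \<not> (0 < T \<omega> \<and> T \<omega> < \<infinity>)} else {})
        \<longleftrightarrow> \<omega> \<in> g -` {k} \<inter> space (strict_past F T)"
        using dyadic_index_cell[of T \<omega> n] dyadic_index_eq[of \<omega> T n k] dyadic_cell_bounds[of \<omega> T n k]
        by (auto simp: g_def)
    qed
    finally show "g -` {k} \<inter> space (strict_past F T) \<in> sets (strict_past F T)" .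
  qed auto
  have "(\<lambda>\<omega>. f (g \<omega>) \<omega>) \<in> borel_measurable (strict_past F T)"
    by (rule measurable_compose_countable[OF f g])
  also have "(\<lambda>\<omega>. f (g \<omega>) \<omega>) = (\<lambda>\<omega>. if 0 < T \<omega> \<and> T \<omega> < \<infinity> then h (dyadic_index T n \<omega>) \<omega> else 0)"
  proof
    fix \<omega>
    show "f (g \<omega>) \<omega> = (if 0 < T \<omega> \<and> T \<omega> < \<infinity> then h (dyadic_index T n \<omega>) \<omega> else 0)"
      using dyadic_index_cell[of T \<omega> n] dyadic_cell_bounds[of \<omega> T n 0] by (auto simp: f_def g_def)
  qed
  finally show ?thesis .
qed

lemma z_dyadic_left_tendsto:
  assumes "has_left_limit \<omega>"
  shows "(\<lambda>n. z (dyadic_left n (dyadic_index T n \<omega>)) \<omega>) \<longlonglongrightarrow> left_limit (\<lambda>t. z t \<omega>) (T \<omega>)"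
proof -
  obtain l where l: "((\<lambda>t. z t \<omega>) \<longlongrightarrow> l) (at_left (T \<omega>))" and T: "0 < T \<omega>" "T \<omega> < \<infinity>"
    using assms by (auto simp: has_left_limit_def)
  have "(\<lambda>n. z (dyadic_left n (dyadic_index T n \<omega>)) \<omega>) \<longlonglongrightarrow> l"
    by (rule filterlim_compose[OF l dyadic_left_at_left[of T, OF T]])
  then show ?thesis
    using left_limit_eqI[OF l T(1)] by simp
qed

lemma left_limit_zero_measurable [measurable]:
  "Measurable.pred (strict_past F T) (\<lambda>\<omega>. 0 < T \<omega> \<and> T \<omega> < \<infinity> \<and> left_limit (\<lambda>t. z t \<omega>) (T \<omega>) = 0)"
proof -
  define y where "y n \<omega> = (if 0 < T \<omega> \<and> T \<omega> < \<infinity> then z (dyadic_left n (dyadic_index T n \<omega>)) \<omega> else 0)" for n \<omega>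
  have [measurable]: "y n \<in> borel_measurable (strict_past F T)" for n
    unfolding y_def by (rule cellwise_measurable) measurable
  have [measurable]: "(\<lambda>\<omega>. lim (\<lambda>n. y n \<omega>)) \<in> borel_measurable (strict_past F T)"
    by (rule borel_measurable_lim_metric) measurable
  \<comment> \<open>The sequence \<open>y\<close> may converge although the path has no left limit,
    and \<open>left_limit\<close> then has its default value; the two cases must be
    separated.\<close>
  have "Measurable.pred (strict_past F T) (\<lambda>\<omega>. (has_left_limit \<omega> \<and> lim (\<lambda>n. y n \<omega>) = 0) \<or>
      (0 < T \<omega> \<and> T \<omega> < \<infinity> \<and> \<not> has_left_limit \<omega> \<and> (THE l::real. False) = 0))"
    by measurable
  also have "(\<lambda>\<omega>. (has_left_limit \<omega> \<and> lim (\<lambda>n. y n \<omega>) = 0) \<or>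
      (0 < T \<omega> \<and> T \<omega> < \<infinity> \<and> \<not> has_left_limit \<omega> \<and> (THE l::real. False) = 0))
    = (\<lambda>\<omega>. 0 < T \<omega> \<and> T \<omega> < \<infinity> \<and> left_limit (\<lambda>t. z t \<omega>) (T \<omega>) = 0)"
  proof
    fix \<omega>
    show "((has_left_limit \<omega> \<and> lim (\<lambda>n. y n \<omega>) = 0) \<or>
      (0 < T \<omega> \<and> T \<omega> < \<infinity> \<and> \<not> has_left_limit \<omega> \<and> (THE l::real. False) = 0))
      \<longleftrightarrow> (0 < T \<omega> \<and> T \<omega> < \<infinity> \<and> left_limit (\<lambda>t. z t \<omega>) (T \<omega>) = 0)"
    proof (cases "has_left_limit \<omega>")
      case True
      then have T: "0 < T \<omega>" "T \<omega> < \<infinity>" by (auto simp: has_left_limit_def)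
      have "lim (\<lambda>n. y n \<omega>) = left_limit (\<lambda>t. z t \<omega>) (T \<omega>)"
        using z_dyadic_left_tendsto[OF True] T by (intro limI) (simp add: y_def)
      then show ?thesis using True T by simp
    next
      case False
      then show ?thesis
        using left_limit_undefined[of "\<lambda>t. z t \<omega>" "T \<omega>"] by (auto simp: has_left_limit_def)
    qed
  qed
  finally show ?thesis .
qed

lemma K_exceptional_iff:
  "\<omega> \<in> K_exceptional z T \<longleftrightarrow> T \<omega> = 0 \<or> T \<omega> = \<infinity> \<or> (0 < T \<omega> \<and> T \<omega> < \<infinity> \<and> left_limit (\<lambda>t. z t \<omega>) (T \<omega>) = 0)"
  by (auto simp: K_exceptional_def zero_less_iff_neq_zero less_top[symmetric])

text \<open>The quotients are only known to converge almost surely, but \<open>lim\<close> of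
  measurable real functions is measurable outright, points of divergence included.\<close>

lemma K_T_measurable: "K_T P F z T \<in> borel_measurable (strict_past F T)"
proof -
  define h where "h n k \<omega> = cell_density P F z T n k \<omega> / (z (dyadic_left n k) \<omega> * cell_prob P F T n k \<omega>)" for n k \<omega>
  have h: "h n k \<in> borel_measurable (F (dyadic_left n k))" for n k
    unfolding h_def cell_density_def cell_prob_def by measurable
  define y where "y n \<omega> = (if 0 < T \<omega> \<and> T \<omega> < \<infinity> then h n (dyadic_index T n \<omega>) \<omega> else 0)" for n \<omega>
  have [measurable]: "y n \<in> borel_measurable (strict_past F T)" for n
    unfolding y_def by (rule cellwise_measurable[OF h])
  have [measurable]: "(\<lambda>\<omega>. lim (\<lambda>n. y n \<omega>)) \<in> borel_measurable (strict_past F T)"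
    by (rule borel_measurable_lim_metric) measurable
  have "K_T P F z T = (\<lambda>\<omega>. if T \<omega> = 0 \<or> T \<omega> = \<infinity> \<or> (0 < T \<omega> \<and> T \<omega> < \<infinity> \<and> left_limit (\<lambda>t. z t \<omega>) (T \<omega>) = 0)
      then 1 else lim (\<lambda>n. y n \<omega>))"
    unfolding K_T_def K_exceptional_iff
    by (auto simp: fun_eq_iff y_def h_def approx_K_def Let_def zero_less_iff_neq_zero less_top[symmetric])
  also have "\<dots> \<in> borel_measurable (strict_past F T)"
    by measurable
  finally show ?thesis .
qed

text \<open>The event belongs to the strict past, so \<open>z_predicted\<close> integrates over it
  to its \<open>\<mu>\<close>-measure; and this is 0 because \<open>z\<close> drops below every
  positive bound before \<open>T\<close>. Existence of the limit is part of the event, since the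
  default of \<open>left_limit\<close> might itself be 0.\<close>

lemma z_predicted_zero:
  "AE \<omega> in P. has_left_limit \<omega> \<and> left_limit (\<lambda>t. z t \<omega>) (T \<omega>) = 0 \<longrightarrow> z_predicted \<omega> = 0"
proof -
  interpret S: sigma_finite_subalgebra P "strict_past F T" by (rule sigma_finite_strict_past)
  define C where "C = {\<omega>\<in>space (strict_past F T). has_left_limit \<omega> \<and>
    (0 < T \<omega> \<and> T \<omega> < \<infinity> \<and> left_limit (\<lambda>t. z t \<omega>) (T \<omega>) = 0)}"
  have C[measurable]: "C \<in> sets (strict_past F T)"
    unfolding C_def by measurable
  have CP[measurable]: "C \<in> sets P" using C by (rule sets_strict_past_P)
  have "C \<subseteq> {\<omega>\<in>space P. \<forall>n. \<exists>q\<in>rational_times. z q \<omega> < 1 / real (Suc n)}"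
  proof (intro subsetI CollectI conjI allI)
    fix \<omega> n assume \<omega>: "\<omega> \<in> C"
    then obtain l where l: "((\<lambda>t. z t \<omega>) \<longlongrightarrow> l) (at_left (T \<omega>))" and T: "0 < T \<omega>" "T \<omega> < \<infinity>"
      by (auto simp: C_def has_left_limit_def)
    have "l = 0" using left_limit_eqI[OF l T(1)] \<omega> by (simp add: C_def)
    then have "eventually (\<lambda>t. z t \<omega> < 1 / real (Suc n)) (at_left (T \<omega>))"
      using l by (intro order_tendstoD(2)) auto
    then obtain b where b: "b < T \<omega>" "\<And>t. b < t \<Longrightarrow> t < T \<omega> \<Longrightarrow> z t \<omega> < 1 / real (Suc n)"
      unfolding eventually_at_left[OF T(1)] by blast
    then show "\<exists>q\<in>rational_times. z q \<omega> < 1 / real (Suc n)"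
      using rational_times_dense[OF b(1)] by blast
  qed (auto simp: C_def)
  then have "C \<in> null_sets \<mu>"
    using CP by (intro null_sets_subset[OF mu_inf_z_zero]) (auto simp: sets_mu)
  then have "emeasure \<mu> C = 0" by auto
  have "(\<integral>\<^sup>+\<omega>. indicator C \<omega> * ennreal (z_predicted \<omega>) \<partial>P) = (\<integral>\<^sup>+\<omega>. indicator C \<omega> * ennreal (z_stopped \<omega>) \<partial>P)"
    by (rule S.real_cond_exp_nn_intg[OF z_stopped_integrable z_stopped_nonneg]) measurable
  also have "\<dots> = emeasure \<mu> C"
    using z_stopped_nn_integral[OF subsetD[OF strict_past_subset_pre_sigma C]] by (simp add: mult.commute)
  finally have "AE \<omega> in P. indicator C \<omega> * ennreal (z_predicted \<omega>) = 0"
    using \<open>emeasure \<mu> C = 0\<close> by (simp add: nn_integral_0_iff_AE)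
  then show ?thesis
    using z_predicted_nonneg AE_space
  proof eventually_elim
    case (elim \<omega>)
    show ?case
    proof
      assume "has_left_limit \<omega> \<and> left_limit (\<lambda>t. z t \<omega>) (T \<omega>) = 0"
      then have "\<omega> \<in> C" using elim by (auto simp: C_def has_left_limit_def)
      then show "z_predicted \<omega> = 0" using elim by (simp add: ennreal_eq_0_iff)
    qed
  qed
qed

lemma approx_K_tendsto:
  "AE \<omega> in P. \<omega> \<notin> K_exceptional z T \<longrightarrow>
     (\<lambda>n. approx_K P F z T n \<omega>) \<longlonglongrightarrow> z_predicted \<omega> / left_limit (\<lambda>t. z t \<omega>) (T \<omega>)"
proof -
  have "AE \<omega> in P. \<forall>t. 0 < t \<and> t < \<infinity> \<longrightarrow> (\<exists>l. ((\<lambda>s. z s \<omega>) \<longlongrightarrow> l) (at_left t))"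
    using density by (simp add: density_process_def)
  with approx_E_tendsto show ?thesis
  proof eventually_elim
    case (elim \<omega>)
    show ?case
    proof
      assume "\<omega> \<notin> K_exceptional z T"
      then have T: "0 < T \<omega>" "T \<omega> < \<infinity>" and nz: "left_limit (\<lambda>t. z t \<omega>) (T \<omega>) \<noteq> 0"
        by (auto simp: K_exceptional_def zero_less_iff_neq_zero less_top[symmetric])
      have "has_left_limit \<omega>" using elim T by (auto simp: has_left_limit_def)
      then have "(\<lambda>n. approx_E P F z T n \<omega> / z (dyadic_left n (dyadic_index T n \<omega>)) \<omega>)
          \<longlonglongrightarrow> z_predicted \<omega> / left_limit (\<lambda>t. z t \<omega>) (T \<omega>)"
        using elim(1) T nz by (intro tendsto_divide z_dyadic_left_tendsto) auto
      then show "(\<lambda>n. approx_K P F z T n \<omega>) \<longlonglongrightarrow> z_predicted \<omega> / left_limit (\<lambda>t. z t \<omega>) (T \<omega>)"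
        by (simp add: approx_K_def approx_E_def Let_def mult.commute)
    qed
  qed
qed

lemma z_predicted_eq:
  "AE \<omega> in P. z_predicted \<omega> = left_limit (\<lambda>t. z t \<omega>) (T \<omega>) * K_T P F z T \<omega>"
proof -
  have "AE \<omega> in P. \<forall>t. 0 < t \<and> t < \<infinity> \<longrightarrow> (\<exists>l. ((\<lambda>s. z s \<omega>) \<longlongrightarrow> l) (at_left t))"
    using density by (simp add: density_process_def)
  with approx_K_tendsto z_predicted_boundary z_predicted_zero z_left_limit_infinity show ?thesis
  proof eventually_elim
    case (elim \<omega>)
    \<comment> \<open>The cases rest on the convention for \<open>left_limit\<close> at 0, the limit
      at infinity, the convergence of the quotients, and the vanishing of
      \<open>z_predicted\<close>, respectively.\<close>
    consider "T \<omega> = 0" | "T \<omega> = \<infinity>" | "\<omega> \<notin> K_exceptional z T"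
      | "0 < T \<omega>" "T \<omega> < \<infinity>" "left_limit (\<lambda>t. z t \<omega>) (T \<omega>) = 0"
      using K_exceptional_iff by blast
    then show ?case
    proof cases
      case 1
      then show ?thesis
        using elim by (simp add: K_T_def K_exceptional_def z_stopped_def left_limit_def)
    next
      case 2
      then show ?thesis
        using elim by (simp add: K_T_def K_exceptional_def z_stopped_def)
    next
      case 3
      then have "K_T P F z T \<omega> = z_predicted \<omega> / left_limit (\<lambda>t. z t \<omega>) (T \<omega>)"
        using elim(1) by (auto simp: K_T_def intro: limI)
      moreover have "left_limit (\<lambda>t. z t \<omega>) (T \<omega>) \<noteq> 0"
        using 3 by (auto simp: K_exceptional_def)
      ultimately show ?thesis by simp
    next
      case 4
      then show ?thesis
        using elim by (auto simp: has_left_limit_def)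
    qed
  qed
qed

end

theorem theorem4:
  fixes P \<mu> :: "'a measure"
    and F :: "ennreal \<Rightarrow> 'a measure"
    and z :: "ennreal \<Rightarrow> 'a \<Rightarrow> real"
    and T :: "'a \<Rightarrow> ennreal"
  assumes "prob_space P" and "prob_space \<mu>"
    and "sets \<mu> = sets P"
    and "absolutely_continuous P \<mu>"
    and "filtration (space P) F"
    and "right_continuous_filtration F"
    and "sets P = sigma_sets (space P) (\<Union>t\<in>{..<\<infinity>}. sets (F t))"
    and "sets (F \<infinity>) = sets P"
    and "density_process P \<mu> F z"
    and "stopping_time F T"
  shows "(\<forall>\<omega>\<in>space P. 0 < T \<omega> \<and> T \<omega> < \<infinity> \<longrightarrow> (\<forall>n. \<exists>!k. \<omega> \<in> dyadic_cell T n k))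
    \<and> (AE \<omega> in P.
          (T \<omega> = 0 \<or> T \<omega> = \<infinity> \<longrightarrow>
             real_cond_exp P (strict_past F T) (\<lambda>\<omega>. z (T \<omega>) \<omega>) \<omega> = z (T \<omega>) \<omega>)
        \<and> (0 < T \<omega> \<and> T \<omega> < \<infinity> \<longrightarrow>
             (\<lambda>n. approx_E P F z T n \<omega>)
               \<longlonglongrightarrow> real_cond_exp P (strict_past F T) (\<lambda>\<omega>. z (T \<omega>) \<omega>) \<omega>))
    \<and> (AE \<omega> in P. \<omega> \<notin> K_exceptional z T \<longrightarrow> convergent (\<lambda>n. approx_K P F z T n \<omega>))
    \<and> K_T P F z T \<in> borel_measurable (strict_past F T)
    \<and> (AE \<omega> in P.
          real_cond_exp P (strict_past F T) (\<lambda>\<omega>. z (T \<omega>) \<omega>) \<omega>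
            = left_limit (\<lambda>t. z t \<omega>) (T \<omega>) * K_T P F z T \<omega>)"
proof -
  interpret density_filtration P \<mu> F z T
    using assms by (intro density_filtration.intro density_filtration_axioms.intro)
  have "AE \<omega> in P. (T \<omega> = 0 \<or> T \<omega> = \<infinity> \<longrightarrow> z_predicted \<omega> = z_stopped \<omega>)
      \<and> (0 < T \<omega> \<and> T \<omega> < \<infinity> \<longrightarrow> (\<lambda>n. approx_E P F z T n \<omega>) \<longlonglongrightarrow> z_predicted \<omega>)"
    using z_predicted_boundary approx_E_tendsto by (rule AE_conjI)
  moreover have "AE \<omega> in P. \<omega> \<notin> K_exceptional z T \<longrightarrow> convergent (\<lambda>n. approx_K P F z T n \<omega>)"
    using approx_K_tendsto by eventually_elim (auto simp: convergent_def)
  ultimately show ?thesis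
    unfolding z_stopped_def[symmetric]
    by (intro conjI ballI allI impI K_T_measurable z_predicted_eq dyadic_cell_unique) simp_all
qed

end
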